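(* Let $\mathcal{L}'=\mathbf{D}_0+\{\sum_{i=1}^{k'}a_i\mathbf{D}_i: a_i\in\mathbb{R}\}$ be an affine set of Hermitian $p\times p$ matrices, where $\mathbf{D}_0\succeq0$ and $\mathbf{D}_1,\dots,\mathbf{D}_{k'}$ are Hermitian, parametrized so that all its elements have trace $p$, and let $\mathcal{S}'=\mathcal{L}'\cap\mathcal{P}(p)$. Let $\boldsymbol\Theta_0\in\mathcal{S}'$ with $\boldsymbol\Theta_0\succ0$, and let $\mathbf{x}_1,\mathbf{x}_2,\dots\in\mathbb{C}^p$ be i.i.d. samples from the complex angular elliptical distribution $\mathcal{U}(\boldsymbol\Theta_0)$. For each $n$, let $\widehat{\boldsymbol\Theta}^{(n)}$ be the COCA estimator, i.e. the $\boldsymbol\Theta$-component of a minimizer of $$\min_{\boldsymbol\Theta\in\mathcal{S}',\,d_1,\dots,d_n}\ \Big\|\boldsymbol\Theta-\frac1n\sum_{i=1}^n d_i\mathbf{x}_i\mathbf{x}_i^H\Big\|\quad\text{s.t.}\quad \boldsymbol\Theta\succeq \frac{1}{p}d_i\mathbf{x}_i\mathbf{x}_i^H,\ \ d_i>0,\ \ i=1,\dots,n,$$ where $\|\cdot\|$ is any matrix norm. Then COCA is an asymptotically consistent estimator of $\boldsymbol\Theta_0$, i.e. $\widehat{\boldsymbol\Theta}^{(n)}\to\boldsymbol\Theta_0$ as $n\to\infty$.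
   Context: $\mathcal{P}(p)$ denotes the closed cone of Hermitian positive semidefinite $p\times p$ matrices; $\succeq$ (resp. $\succ$) denotes the Loewner order (resp. positive definiteness). The complex angular elliptical distribution $\mathcal{U}(\boldsymbol\Theta_0)$, for Hermitian $\boldsymbol\Theta_0\succ 0$, is the distribution on the complex unit sphere $\{\mathbf{x}\in\mathbb{C}^p:\|\mathbf{x}\|=1\}$ with density $p(\mathbf{x})=\frac{(p-1)!}{\pi^p}\frac{1}{|\boldsymbol\Theta_0|(\mathbf{x}^H\boldsymbol\Theta_0^{-1}\mathbf{x})^p}$; equivalently it is the law of $\mathbf{s}/\|\mathbf{s}\|$ for a generalized elliptical vector $\mathbf{s}=r\boldsymbol\Lambda\mathbf{u}$ with $\boldsymbol\Lambda\boldsymbol\Lambda^H=\boldsymbol\Theta_0$, $\mathbf{u}$ uniform on the complex unit sphere and $r\ge0$ with no atom at $0$. Since the model determines $\boldsymbol\Theta_0$ only up to a positive scalar, the scale is fixed by requiring $\mathrm{Tr}(\boldsymbol\Theta_0)=p$ (built into $\mathcal{S}'$). *)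

theory Defs
  imports "HOL-Probability.Probability"
begin

type_synonym 'p cmat = "complex^'p^'p"

definition adj :: "'p::finite cmat \<Rightarrow> 'p cmat" where
  "adj A = (\<chi> i j. cnj (A $ j $ i))"

definition hermitian :: "'p::finite cmat \<Rightarrow> bool" where
  "hermitian A \<longleftrightarrow> adj A = A"

definition qform :: "'p::finite cmat \<Rightarrow> complex^'p \<Rightarrow> complex" where
  "qform A x = (\<Sum>i\<in>UNIV. \<Sum>j\<in>UNIV. cnj (x $ i) * A $ i $ j * x $ j)"

definition psd :: "'p::finite cmat \<Rightarrow> bool" where
  "psd A \<longleftrightarrow> hermitian A \<and> (\<forall>x. 0 \<le> Re (qform A x))"

definition pd :: "'p::finite cmat \<Rightarrow> bool" where
  "pd A \<longleftrightarrow> hermitian A \<and> (\<forall>x. x \<noteq> 0 \<longrightarrow> 0 < Re (qform A x))"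

definition mtrace :: "'p::finite cmat \<Rightarrow> complex" where
  "mtrace A = (\<Sum>i\<in>UNIV. A $ i $ i)"

definition outer :: "complex^'p \<Rightarrow> complex^'p^'p" where
  "outer x = (\<chi> i j. x $ i * cnj (x $ j))"

definition cscale :: "complex \<Rightarrow> 'p::finite cmat \<Rightarrow> 'p cmat" where
  "cscale c A = (\<chi> i j. c * A $ i $ j)"

definition matrix_norm :: "('p::finite cmat \<Rightarrow> real) \<Rightarrow> bool" where
  "matrix_norm N \<longleftrightarrow>
     (\<forall>A. N A = 0 \<longleftrightarrow> A = 0) \<and>
     (\<forall>A B. N (A + B) \<le> N A + N B) \<and>
     (\<forall>c A. N (cscale c A) = cmod c * N A)"

definition affset :: "'p::finite cmat \<Rightarrow> (nat \<Rightarrow> 'p cmat) \<Rightarrow> nat \<Rightarrow> 'p cmat set" where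
  "affset D0 D k = {D0 + (\<Sum>i\<in>{1..k}. a i *\<^sub>R D i) | a. True}"

definition Sset :: "'p::finite cmat \<Rightarrow> (nat \<Rightarrow> 'p cmat) \<Rightarrow> nat \<Rightarrow> 'p cmat set" where
  "Sset D0 D k = affset D0 D k \<inter> {A. psd A}"

definition cgauss :: "(complex^'p::finite) measure" where
  "cgauss = density lborel (\<lambda>z. ennreal (exp (- (norm z ^ 2)) / pi ^ CARD('p)))"

text \<open>Complex angular elliptical distribution U(Theta): law of s/|s| with
  s = Lambda z, Lambda Lambda^H = Theta, z standard complex Gaussian
  (a generalized elliptical vector r Lambda u with r = |z| having no atom at 0).\<close>
definition cae_dist :: "'p::finite cmat \<Rightarrow> (complex^'p) measure" where
  "cae_dist Theta =
     (let L = (SOME L. L ** adj L = Theta)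
      in distr cgauss borel (\<lambda>z. (1 / norm (L *v z)) *\<^sub>R (L *v z)))"

definition coca_feasible ::
  "'p::finite cmat \<Rightarrow> (nat \<Rightarrow> 'p cmat) \<Rightarrow> nat \<Rightarrow> (nat \<Rightarrow> complex^'p) \<Rightarrow> nat
    \<Rightarrow> 'p cmat \<Rightarrow> (nat \<Rightarrow> real) \<Rightarrow> bool" where
  "coca_feasible D0 D k x n Theta d \<longleftrightarrow>
     Theta \<in> Sset D0 D k \<and>
     (\<forall>i<n. 0 < d i \<and> psd (Theta - (d i / real CARD('p)) *\<^sub>R outer (x i)))"

definition coca_obj ::
  "('p::finite cmat \<Rightarrow> real) \<Rightarrow> (nat \<Rightarrow> complex^'p) \<Rightarrow> nat \<Rightarrow> 'p cmat \<Rightarrow> (nat \<Rightarrow> real) \<Rightarrow> real" where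
  "coca_obj N x n Theta d = N (Theta - (1 / real n) *\<^sub>R (\<Sum>i<n. d i *\<^sub>R outer (x i)))"

definition is_coca_estimate ::
  "('p::finite cmat \<Rightarrow> real) \<Rightarrow> 'p cmat \<Rightarrow> (nat \<Rightarrow> 'p cmat) \<Rightarrow> nat \<Rightarrow> (nat \<Rightarrow> complex^'p)
    \<Rightarrow> nat \<Rightarrow> 'p cmat \<Rightarrow> bool" where
  "is_coca_estimate N D0 D k x n That \<longleftrightarrow>
     (\<exists>dh. coca_feasible D0 D k x n That dh \<and>
        (\<forall>Theta d. coca_feasible D0 D k x n Theta d \<longrightarrow>
            coca_obj N x n That dh \<le> coca_obj N x n Theta d))"

end

theory Submission
  imports Defs
begin

text \<open>Write \<open>\<Theta>\<^sub>0 = L L\<^sup>H\<close> and \<open>K = L\<^sup>-\<^sup>1\<close>, so that the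
  directions \<open>u\<^sub>i = K x\<^sub>i / \<parallel>K x\<^sub>i\<parallel>\<close> are uniform on the sphere and their empirical second moment tends to
  \<open>I / p\<close>. Hence \<open>\<Theta>\<^sub>0\<close> with \<open>d\<^sub>i = p / \<parallel>K x\<^sub>i\<parallel>\<^sup>2\<close> is feasible with objective tending to \<open>0\<close>,
  and so does the objective of the estimates \<open>T\<^sub>n\<close>. Put \<open>M\<^sub>n = K T\<^sub>n K\<^sup>H\<close>. Testing the constraint in the direction \<open>u\<^sub>i\<close>
  gives \<open>d\<^sub>i \<parallel>K x\<^sub>i\<parallel>\<^sup>2 / p \<le> \<langle>u\<^sub>i, M\<^sub>n u\<^sub>i\<rangle>\<close>, and both sides have asymptotically the
  same mean (the trace of \<open>M\<^sub>n\<close>, divided by \<open>p\<close>). A slightly better test vector gains a multiple of the squared norm of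
  \<open>M\<^sub>n u\<^sub>i - \<langle>u\<^sub>i, M\<^sub>n u\<^sub>i\<rangle> u\<^sub>i\<close>, which must therefore vanish on average. By the law of large numbers,
  applied to a countable dense set of matrices in place of \<open>M\<^sub>n\<close>, every direction is an eigenvector of every
  cluster point of \<open>M\<^sub>n\<close>; so every cluster point of \<open>T\<^sub>n\<close> is a multiple of \<open>\<Theta>\<^sub>0\<close>, and the trace fixes the scale.\<close>

section \<open>Strong law for bounded samples\<close>

text \<open>Hoeffding's inequality bounds the probability that the mean deviates by \<open>e\<close>
  by a geometric sequence in \<open>n\<close>. This is summable, so Borel-Cantelli applies to each
  tolerance, and the tolerances \<open>inverse (real (Suc m))\<close> suffice.\<close>

lemma (in prob_space) strong_law_bounded_iid_real:
  fixes h :: "'b \<Rightarrow> real"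
  assumes indep: "indep_vars (\<lambda>_. S) X (UNIV :: nat set)"
    and dist: "\<And>i. distr M S (X i) = P"
    and h [measurable]: "h \<in> borel_measurable S"
    and bound: "\<And>x. \<bar>h x\<bar> \<le> B"
  shows "AE w in M. (\<lambda>n. (\<Sum>i<n. h (X i w)) / real n) \<longlonglongrightarrow> (\<integral>x. h x \<partial>P)"
proof -
  have X [measurable]: "X i \<in> measurable M S" for i
    using indep by (auto simp: indep_vars_def)
  define \<mu> where "\<mu> = (\<integral>x. h x \<partial>P)"
  \<comment> \<open>The length of the interval \<open>{- B..B + 1}\<close>; the extra
    \<open>1\<close> keeps it nondegenerate when \<open>B = 0\<close>.\<close>
  define c where "c = 2 * B + 1"
  have "0 \<le> B" using bound[of undefined] by linarith
  then have c: "c > 0" by (simp add: c_def)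
  have indep': "indep_vars (\<lambda>_. borel) (\<lambda>i w. h (X i w)) (UNIV :: nat set)"
    by (rule indep_vars_compose2[OF indep]) simp
  have dist': "distr M borel (\<lambda>w. h (X i w)) = distr M borel (\<lambda>w. h (X 0 w))" for i
  proof -
    have "distr M borel (\<lambda>w. h (X j w)) = distr P borel h" for j
      unfolding dist[of j, symmetric] by (subst distr_distr) (auto simp: o_def)
    then show ?thesis by simp
  qed
  have \<mu>: "expectation (\<lambda>w. h (X 0 w)) = \<mu>"
    unfolding \<mu>_def dist[of 0, symmetric] by (subst integral_distr) auto
  define A where "A e n = {w \<in> space M. e \<le> \<bar>(\<Sum>i<n. h (X i w)) / real n - \<mu>\<bar>}" for e n
  have A_meas [measurable]: "A e n \<in> sets M" for e n
    unfolding A_def by measurable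
  have prob_A: "prob (A e n) \<le> 2 * exp (- 2 * e\<^sup>2 / c\<^sup>2) ^ n" if "e > 0" "n \<ge> 1" for e n
  proof -
    interpret H: Hoeffding_ineq_iid M "{..<n}" "\<lambda>i w. h (X i w)" "\<lambda>w. h (X 0 w)" "- B" "B + 1"
        "expectation (\<lambda>w. h (X 0 w))"
    proof unfold_locales
      show "indep_vars (\<lambda>_. borel) (\<lambda>i w. h (X i w)) {..<n}"
        by (rule indep_vars_subset[OF indep']) simp
      show "AE x in M. h (X 0 x) \<in> {- B..B + 1}"
        using bound by (intro AE_I2) (smt (verit) atLeastAtMost_iff)
    qed (use dist' in \<open>auto\<close>)
    have "prob (A e n) \<le> 2 * exp (- 2 * real n * e\<^sup>2 / c\<^sup>2)"
      using H.Hoeffding_ineq_abs_ge'[of e] that \<open>0 \<le> B\<close>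
      unfolding A_def \<mu> c_def by (auto simp: algebra_simps lessThan_empty_iff)
    also have "exp (- 2 * real n * e\<^sup>2 / c\<^sup>2) = exp (- 2 * e\<^sup>2 / c\<^sup>2) ^ n"
      by (simp add: exp_of_nat_mult[symmetric] mult_ac)
    finally show ?thesis .
  qed
  have ev: "AE w in M. \<forall>\<^sub>F n in sequentially. w \<in> space M - A e n" if "e > 0" for e
  proof (rule borel_cantelli_AE1)
    have "summable (\<lambda>n. 2 * exp (- 2 * e\<^sup>2 / c\<^sup>2) ^ n)"
      using that c by (intro summable_mult summable_geometric) (auto simp: field_simps)
    then show "summable (\<lambda>n. prob (A e n))"
      by (rule summable_comparison_test'[where N = 1]) (use prob_A[OF that] in auto)
  qed (auto simp: emeasure_eq_measure)
  have "AE w in M. \<forall>m::nat. \<forall>\<^sub>F n in sequentially. w \<in> space M - A (inverse (real (Suc m))) n"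
    by (subst AE_all_countable) (intro allI ev, simp)
  then show ?thesis
  proof eventually_elim
    case (elim w)
    show ?case unfolding \<mu>_def[symmetric]
    proof (rule tendstoI)
      fix e :: real assume "e > 0"
      then obtain m where m: "inverse (real (Suc m)) < e"
        using reals_Archimedean by blast
      show "\<forall>\<^sub>F n in sequentially. dist ((\<Sum>i<n. h (X i w)) / real n) \<mu> < e"
        using elim[rule_format, of m] by eventually_elim (use m in \<open>auto simp: A_def dist_real_def\<close>)
    qed
  qed
qed

lemma (in prob_space) strong_law_bounded_iid_complex:
  fixes h :: "'b \<Rightarrow> complex"
  assumes indep: "indep_vars (\<lambda>_. S) X (UNIV :: nat set)"
    and dist: "\<And>i. distr M S (X i) = P"
    and h [measurable]: "h \<in> borel_measurable S"
    and bound: "\<And>x. cmod (h x) \<le> B"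
  shows "AE w in M. (\<lambda>n. (\<Sum>i<n. h (X i w)) / of_nat n) \<longlonglongrightarrow> (\<integral>x. h x \<partial>P)"
proof -
  have X [measurable]: "X i \<in> measurable M S" for i
    using indep by (auto simp: indep_vars_def)
  interpret P: prob_space P
    unfolding dist[of 0, symmetric] by (rule prob_space_distr) simp
  have [measurable]: "h \<in> borel_measurable P"
    unfolding dist[of 0, symmetric] by simp
  have int: "integrable P h"
    using bound by (intro P.integrable_const_bound[of _ B]) auto
  have "AE w in M. (\<lambda>n. (\<Sum>i<n. Re (h (X i w))) / real n) \<longlonglongrightarrow> (\<integral>x. Re (h x) \<partial>P)"
    by (rule strong_law_bounded_iid_real[OF indep dist, of _ B])
       (use bound order_trans[OF abs_Re_le_cmod] in auto)
  moreover have "AE w in M. (\<lambda>n. (\<Sum>i<n. Im (h (X i w))) / real n) \<longlonglongrightarrow> (\<integral>x. Im (h x) \<partial>P)"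
    by (rule strong_law_bounded_iid_real[OF indep dist, of _ B])
       (use bound order_trans[OF abs_Im_le_cmod] in auto)
  ultimately show ?thesis
  proof eventually_elim
    case (elim w)
    then show ?case
      using int by (simp add: tendsto_complex_iff Re_divide_of_nat Im_divide_of_nat)
  qed
qed

section \<open>Uniform directions from the Gaussian\<close>

text \<open>The Gaussian density is a function of the norm, so it is unchanged by a norm-preserving
  map.\<close>

lemma distr_cgauss_isometry:
  fixes R :: "complex^'p::finite \<Rightarrow> complex^'p"
  assumes "distr lborel borel R = lborel" "R \<in> borel_measurable borel" "\<And>z. norm (R z) = norm z"
  shows "distr cgauss borel R = cgauss"
proof -
  have [measurable]: "R \<in> measurable lborel borel" using assms(2) by simp
  have "cgauss = density (distr lborel borel R)
      (\<lambda>z. ennreal (exp (- (norm z ^ 2)) / pi ^ CARD('p)))"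
    by (simp add: cgauss_def assms(1))
  also have "\<dots> = distr cgauss borel R"
    unfolding cgauss_def by (subst density_distr) (simp_all add: assms(3))
  finally show ?thesis by simp
qed

section \<open>Invariance of the Gaussian under sign flips and coordinate swaps\<close>

definition flip :: "'p \<Rightarrow> complex^'p::finite \<Rightarrow> complex^'p" where
  "flip a z = (\<chi> i. if i = a then - z $ i else z $ i)"

definition swap :: "'p \<Rightarrow> 'p \<Rightarrow> complex^'p::finite \<Rightarrow> complex^'p" where
  "swap a b z = (\<chi> i. z $ (Transposition.transpose a b i))"

lemma linear_flip: "linear (flip a)"
  by (rule linearI) (auto simp: flip_def vec_eq_iff)

lemma linear_swap: "linear (swap a b)"
  by (rule linearI) (auto simp: swap_def vec_eq_iff)

lemma measurable_flip [measurable]: "flip a \<in> borel_measurable borel"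
  by (intro borel_measurable_continuous_onI linear_continuous_on)
     (simp add: linear_conv_bounded_linear[symmetric] linear_flip)

lemma measurable_swap [measurable]: "swap a b \<in> borel_measurable borel"
  by (intro borel_measurable_continuous_onI linear_continuous_on)
     (simp add: linear_conv_bounded_linear[symmetric] linear_swap)

lemma norm_flip [simp]: "norm (flip a z) = norm z"
  unfolding norm_vec_def L2_set_def flip_def by (auto intro!: arg_cong[where f = sqrt] sum.cong)

lemma norm_swap [simp]: "norm (swap a b z) = norm z"
proof -
  have "(\<Sum>i\<in>UNIV. (norm (z $ Transposition.transpose a b i))\<^sup>2) = (\<Sum>i\<in>UNIV. (norm (z $ i))\<^sup>2)"
    by (rule sum.reindex_bij_betw) simp
  then show ?thesis
    unfolding norm_vec_def L2_set_def swap_def by simp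
qed

text \<open>In the real basis \<open>Basis\<close> the flip is diagonal with entries
  \<open>1\<close> and \<open>-1\<close>, so its Jacobian factor is \<open>1\<close>.\<close>

lemma distr_cgauss_flip: "distr cgauss borel (flip a) = cgauss"
proof (rule distr_cgauss_isometry)
  \<comment> \<open>\<open>range (axis a)\<close> contains both basis vectors of the complex
    coordinate \<open>a\<close>, the real and the imaginary one.\<close>
  define c :: "complex^'a \<Rightarrow> real" where "c = (\<lambda>j. if j \<in> range (axis a) then -1 else 1)"
  have flip_eq: "flip a x = 0 + (\<Sum>j\<in>Basis. (c j * (x \<bullet> j)) *\<^sub>R j)" for x
  proof (rule euclidean_eqI)
    fix b :: "complex^'a" assume b: "b \<in> Basis"
    then obtain i u where iu: "b = axis i u" "u \<in> Basis"
      by (auto simp: Basis_vec_def)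
    have "b \<in> range (axis a) \<longleftrightarrow> i = a"
      using iu nonzero_Basis[of u] by (auto simp: axis_eq_axis)
    then have "flip a x \<bullet> b = c b * (x \<bullet> b)"
      by (auto simp: iu(1) inner_axis flip_def c_def)
    also have "\<dots> = (0 + (\<Sum>j\<in>Basis. (c j * (x \<bullet> j)) *\<^sub>R j)) \<bullet> b"
      using b by (simp add: inner_sum_left_Basis)
    finally show "flip a x \<bullet> b = (0 + (\<Sum>j\<in>Basis. (c j * (x \<bullet> j)) *\<^sub>R j)) \<bullet> b" .
  qed
  have "lborel = density (distr lborel borel (flip a)) (\<lambda>_. \<Prod>j\<in>Basis. \<bar>c j\<bar>)"
    unfolding flip_eq by (rule lborel_affine_euclidean) (simp add: c_def)
  also have "(\<Prod>j\<in>Basis. \<bar>c j\<bar>) = 1"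
    by (intro prod.neutral) (simp add: c_def)
  finally show "distr lborel borel (flip a) = lborel"
    by (simp add: density_1)
qed auto

text \<open>A swap permutes \<open>Basis\<close>, so preimages of boxes are boxes with the same side
  lengths, and Lebesgue measure is determined by its values on boxes.\<close>

lemma distr_cgauss_swap: "distr cgauss borel (swap a b) = cgauss"
proof (rule distr_cgauss_isometry)
  have inner_swap: "swap a b x \<bullet> y = x \<bullet> swap a b y" for x y :: "complex^'a"
    unfolding inner_vec_def swap_def
    by (rule sum.reindex_bij_witness[of _ "Transposition.transpose a b" "Transposition.transpose a b"]) auto
  have swap_swap: "swap a b (swap a b x) = x" for x :: "complex^'a"
    by (simp add: swap_def vec_eq_iff)
  have swap_Basis: "swap a b x \<in> Basis" if x: "x \<in> Basis" for x :: "complex^'a"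
  proof -
    obtain i u where iu: "x = axis i u" "u \<in> Basis"
      using x by (auto simp: Basis_vec_def)
    have "swap a b x = axis (Transposition.transpose a b i) u"
      unfolding iu swap_def by (auto simp: vec_eq_iff axis_def transpose_eq_iff)
    then show ?thesis using iu(2) by (auto simp: Basis_vec_def)
  qed
  show "distr lborel borel (swap a b) = lborel"
  proof (rule lborel_eqI[symmetric])
    fix l u :: "complex^'a" assume lu: "\<And>b. b \<in> Basis \<Longrightarrow> l \<bullet> b \<le> u \<bullet> b"
    have box: "swap a b -` box l u = box (swap a b l) (swap a b u)"
    proof (intro set_eqI)
      fix x
      show "x \<in> swap a b -` box l u \<longleftrightarrow> x \<in> box (swap a b l) (swap a b u)"
        unfolding mem_box vimage_eq inner_swap by (metis swap_Basis swap_swap)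
    qed
    have "emeasure (distr lborel borel (swap a b)) (box l u)
        = emeasure lborel (box (swap a b l) (swap a b u))"
      by (subst emeasure_distr) (auto simp: box)
    also have "\<dots> = (\<Prod>x\<in>Basis. (swap a b u - swap a b l) \<bullet> x)"
      using lu swap_Basis by (subst emeasure_lborel_box) (auto simp: inner_swap)
    also have "(\<Prod>x\<in>Basis. (swap a b u - swap a b l) \<bullet> x) = (\<Prod>x\<in>Basis. (u - l) \<bullet> x)"
      by (rule prod.reindex_bij_witness[of _ "swap a b" "swap a b"])
         (auto simp: swap_swap swap_Basis inner_diff_left inner_swap)
    finally show "emeasure (distr lborel borel (swap a b)) (box l u) = (\<Prod>x\<in>Basis. (u - l) \<bullet> x)" .
  qed simp
qed auto

section \<open>Second moment of the normalized Gaussian vector\<close>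

lemma sets_cgauss [measurable_cong, simp]: "sets cgauss = sets borel"
  by (simp add: cgauss_def)

lemma space_cgauss [simp]: "space cgauss = UNIV"
  by (simp add: cgauss_def)

text \<open>The density is strictly positive, so both measures have the same null sets.\<close>

lemma AE_cgauss_iff: "(AE z in cgauss. Q z) \<longleftrightarrow> (AE z in lborel. Q z)"
  for Q :: "complex^'p::finite \<Rightarrow> bool"
  unfolding cgauss_def by (subst AE_density) auto

lemma AE_cgauss_nonzero: "AE z in (cgauss :: (complex^'p::finite) measure). z \<noteq> 0"
  unfolding AE_cgauss_iff by (rule AE_lborel_singleton)

lemma borel_measurable_sgn_vec [measurable]:
  "(sgn :: 'a::{real_normed_vector, second_countable_topology} \<Rightarrow> 'a) \<in> borel_measurable borel"
  unfolding sgn_div_norm[abs_def] by measurable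

lemma measurable_vec_nth_complex [measurable]:
  "(\<lambda>z :: complex^'p::finite. z $ i) \<in> borel_measurable borel"
  by (intro borel_measurable_continuous_onI continuous_intros)

lemma measurable_cnj [measurable]: "cnj \<in> borel_measurable borel"
  by (intro borel_measurable_continuous_onI continuous_intros)

lemma norm_nth_sgn_le: "norm (sgn z $ i) \<le> 1" for z :: "complex^'p::finite"
  using Finite_Cartesian_Product.norm_nth_le[of "sgn z" i] by (simp add: norm_sgn split: if_splits)

text \<open>Flipping coordinate \<open>a\<close> negates the off-diagonal moments, which therefore
  vanish. Swaps make the diagonal ones equal, and these sum to the squared norm of
  \<open>sgn z\<close>, which is \<open>1\<close> almost everywhere.\<close>

lemma integral_cgauss_outer_sgn:
  assumes "prob_space (cgauss :: (complex^'p::finite) measure)"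
  shows "(\<integral>z. sgn z $ a * cnj (sgn z $ b) \<partial>(cgauss :: (complex^'p) measure))
    = (if a = b then 1 / of_nat CARD('p) else 0)"
proof -
  interpret prob_space "cgauss :: (complex^'p) measure" by fact
  define q where "q a b z = sgn z $ a * cnj (sgn z $ b)" for a b and z :: "complex^'p"
  have q_meas [measurable]: "q a b \<in> borel_measurable borel" for a b
    unfolding q_def by measurable
  have q_int: "integrable cgauss (q a b)" for a b
  proof (rule integrable_const_bound[of _ 1])
    have "norm (q a b z) \<le> 1" for z
      unfolding q_def norm_mult complex_mod_cnj
      by (intro mult_le_one norm_nth_sgn_le norm_ge_zero)
    then show "AE z in cgauss. norm (q a b z) \<le> 1" by simp
  qed simp
  show ?thesis
  proof (cases "a = b")
    case False
    have "(\<integral>z. q a b z \<partial>cgauss) = (\<integral>z. q a b z \<partial>(distr cgauss borel (flip a)))"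
      by (simp add: distr_cgauss_flip)
    also have "\<dots> = (\<integral>z. q a b (flip a z) \<partial>cgauss)"
      by (subst integral_distr) auto
    also have "\<dots> = (\<integral>z. - q a b z \<partial>cgauss)"
      using False by (intro Bochner_Integration.integral_cong)
        (auto simp: q_def sgn_div_norm, auto simp: flip_def)
    finally show ?thesis using False by (simp add: q_def)
  next
    case True
    have eq: "(\<integral>z. q c c z \<partial>cgauss) = (\<integral>z. q a a z \<partial>cgauss)" for c
    proof -
      have "(\<integral>z. q c c z \<partial>cgauss) = (\<integral>z. q c c z \<partial>(distr cgauss borel (swap a c)))"
        by (simp add: distr_cgauss_swap)
      also have "\<dots> = (\<integral>z. q c c (swap a c z) \<partial>cgauss)"
        by (subst integral_distr) auto
      also have "\<dots> = (\<integral>z. q a a z \<partial>cgauss)"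
        by (intro Bochner_Integration.integral_cong)
          (auto simp: q_def sgn_div_norm, auto simp: swap_def)
      finally show ?thesis .
    qed
    have "of_nat CARD('p) * (\<integral>z. q a a z \<partial>cgauss) = (\<Sum>c\<in>UNIV. \<integral>z. q c c z \<partial>cgauss)"
      by (simp add: sum.cong[OF refl eq])
    also have "\<dots> = (\<integral>z. (\<Sum>c\<in>UNIV. q c c z) \<partial>cgauss)"
      using q_int by (subst Bochner_Integration.integral_sum) auto
    also have "\<dots> = (\<integral>z. 1 \<partial>(cgauss :: (complex^'p) measure))"
    proof (rule integral_cong_AE)
      show "AE z in cgauss. (\<Sum>c\<in>UNIV. q c c z) = 1"
        using AE_cgauss_nonzero
      proof eventually_elim
        case (elim z)
        have "(\<Sum>c\<in>UNIV. q c c z) = of_real ((norm (sgn z))\<^sup>2)"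
          by (simp add: q_def norm_vec_def L2_set_def complex_norm_square[symmetric]
              sum_nonneg del: of_real_power)
        then show ?case using elim by (simp add: norm_sgn)
      qed
    qed auto
    finally show ?thesis
      using True by (simp add: q_def field_simps prob_space[simplified])
  qed
qed

text \<open>The set where \<open>f\<close> differs from \<open>c\<close> is open and null, hence
  empty.\<close>

lemma continuous_eq_if_AE_lborel:
  fixes f :: "'a::euclidean_space \<Rightarrow> 'b::t2_space"
  assumes "AE z in lborel. f z = c" "continuous_on UNIV f"
  shows "f z = c"
proof (rule ccontr)
  assume "f z \<noteq> c"
  have "open (f -` (- {c}))"
    using assms(2) by (intro open_vimage) auto
  moreover have "negligible (f -` (- {c}))"
    using assms(1) calculation unfolding negligible_iff_null_sets
    by (intro null_sets_completionI) (simp add: AE_iff_null_sets)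
  ultimately show False using open_not_negligible \<open>f z \<noteq> c\<close> by fastforce
qed

section \<open>Hermitian matrices\<close>

text \<open>Links the real-valued inner product of \<open>complex^'n\<close> to the Hermitian form,
  so that quadratic forms can be handled by real Euclidean geometry.\<close>

lemma inner_complex_vec: "x \<bullet> y = Re (\<Sum>i\<in>UNIV. cnj (x $ i) * y $ i)" for x y :: "complex^'n::finite"
  by (simp add: inner_vec_def inner_complex_def)

lemma Re_qform: "Re (qform A x) = x \<bullet> (A *v x)"
  by (simp add: qform_def inner_complex_vec matrix_vector_mult_def sum_distrib_left mult.assoc)

lemma inner_matrix_vector: "x \<bullet> (A *v y) = (adj A *v x) \<bullet> y" for A :: "'n::finite cmat"
proof -
  have "(\<Sum>i\<in>UNIV. \<Sum>j\<in>UNIV. cnj (x $ i) * (A $ i $ j * y $ j))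
      = (\<Sum>j\<in>UNIV. \<Sum>i\<in>UNIV. cnj (cnj (A $ i $ j) * x $ i) * y $ j)"
    by (subst sum.swap) (simp add: mult_ac)
  then show ?thesis
    by (simp add: inner_complex_vec matrix_vector_mult_def adj_def sum_distrib_left sum_distrib_right
        del: Re_sum cnj.simps)
qed

lemma adj_adj [simp]: "adj (adj A) = A"
  by (simp add: adj_def vec_eq_iff)

lemma adj_mult: "adj (A ** B) = adj B ** adj A"
  by (simp add: adj_def matrix_matrix_mult_def vec_eq_iff mult.commute)

lemma adj_mat_1 [simp]: "adj (mat 1) = mat 1"
  by (auto simp: adj_def mat_def vec_eq_iff)

lemma adj_diff: "adj (A - B) = adj A - adj B"
  by (simp add: adj_def vec_eq_iff)

lemma adj_outer [simp]: "adj (outer x) = outer x"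
  by (simp add: adj_def outer_def vec_eq_iff mult.commute)

lemma matrix_vector_mult_scaleR_right: "A *v (c *\<^sub>R x) = c *\<^sub>R (A *v x)" for A :: "complex^'n^'m"
  by (simp add: vec_eq_iff matrix_vector_mult_def scaleR_sum_right)

lemma matrix_vector_mult_scaleR_left: "(c *\<^sub>R A) *v x = c *\<^sub>R (A *v x)" for A :: "complex^'n^'m"
  by (simp add: vec_eq_iff matrix_vector_mult_def scaleR_sum_right)

lemma matrix_mult_scaleR_left: "(c *\<^sub>R A) ** B = c *\<^sub>R (A ** B)" for A :: "complex^'n^'m"
  by (simp add: vec_eq_iff matrix_matrix_mult_def scaleR_sum_right)

lemma matrix_mult_scaleR_right: "A ** (c *\<^sub>R B) = c *\<^sub>R (A ** B)" for A :: "complex^'n^'m"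
  by (simp add: vec_eq_iff matrix_matrix_mult_def scaleR_sum_right)

lemma matrix_diff_distrib: "A ** (B - C) = A ** B - A ** C" "(B - C) ** E = B ** E - C ** E"
  for A B C :: "complex^'n^'n"
  by (simp_all add: vec_eq_iff matrix_matrix_mult_def algebra_simps sum_subtractf)

lemma matrix_sum_distrib: "A ** (\<Sum>i\<in>I. B i) = (\<Sum>i\<in>I. A ** B i)"
  "(\<Sum>i\<in>I. B i) ** A = (\<Sum>i\<in>I. B i ** A)" for A :: "complex^'n^'n"
  by (simp_all add: vec_eq_iff matrix_matrix_mult_def sum_distrib_left sum_distrib_right sum.swap[of _ I])

lemma outer_mult_vector: "outer x *v w = (\<Sum>j\<in>UNIV. cnj (x $ j) * w $ j) *s x"
  by (simp add: outer_def matrix_vector_mult_def vec_eq_iff sum_distrib_left sum_distrib_right mult_ac)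

lemma inner_outer: "w \<bullet> (outer x *v w) = (cmod (\<Sum>j\<in>UNIV. cnj (x $ j) * w $ j))\<^sup>2"
proof -
  let ?c = "\<Sum>j\<in>UNIV. cnj (x $ j) * w $ j"
  have "w \<bullet> (outer x *v w) = Re (?c * (\<Sum>j\<in>UNIV. cnj (w $ j) * x $ j))"
    by (simp add: outer_mult_vector inner_complex_vec sum_distrib_left mult_ac del: Re_sum cnj.simps)
  also have "(\<Sum>j\<in>UNIV. cnj (w $ j) * x $ j) = cnj ?c"
    by (simp add: mult.commute)
  also have "Re (?c * cnj ?c) = (cmod ?c)\<^sup>2"
    by (simp only: complex_norm_square[symmetric] Re_complex_of_real)
  finally show ?thesis .
qed

text \<open>A real part is at most the modulus in absolute value. Bounds the rank-one term of the
  constraint from below at a test vector.\<close>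

lemma inner_outer_ge: "(x \<bullet> w)\<^sup>2 \<le> w \<bullet> (outer x *v w)"
  unfolding inner_outer inner_complex_vec[of x w]
  by (rule power2_le_iff_abs_le[THEN iffD2]) (rule norm_ge_zero abs_Re_le_cmod)+

text \<open>Cauchy-Schwarz for the Hermitian form; it makes \<open>mat 1 - outer u\<close> positive
  semidefinite for a unit vector \<open>u\<close>.\<close>

lemma inner_outer_le: "w \<bullet> (outer x *v w) \<le> (norm x)\<^sup>2 * (norm w)\<^sup>2"
proof -
  have "cmod (\<Sum>j\<in>UNIV. cnj (x $ j) * w $ j) \<le> (\<Sum>j\<in>UNIV. \<bar>cmod (x $ j)\<bar> * \<bar>cmod (w $ j)\<bar>)"
    by (rule order_trans[OF norm_sum]) (simp add: norm_mult)
  also have "\<dots> \<le> norm x * norm w"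
    unfolding norm_vec_def by (rule L2_set_mult_ineq)
  finally show ?thesis
    unfolding inner_outer power_mult_distrib[symmetric] by (rule power_mono) simp
qed

lemma norm_matrix_vector_mult_le: "norm (A *v x) \<le> norm A * norm x" for A :: "complex^'n::finite^'m::finite"
proof -
  have comp: "norm ((A *v x) $ i) \<le> norm (A $ i) * norm x" for i
  proof -
    have "norm ((A *v x) $ i) \<le> (\<Sum>j\<in>UNIV. \<bar>cmod (A $ i $ j)\<bar> * \<bar>cmod (x $ j)\<bar>)"
      unfolding matrix_vector_mult_def by (simp, rule order_trans[OF norm_sum]) (simp add: norm_mult)
    also have "\<dots> \<le> norm (A $ i) * norm x"
      unfolding norm_vec_def[of x] norm_vec_def[of "A $ i"] by (rule L2_set_mult_ineq)
    finally show ?thesis .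
  qed
  have "norm (A *v x) \<le> L2_set (\<lambda>i. norm (A $ i) * norm x) UNIV"
    unfolding norm_vec_def[of "A *v x"] by (rule L2_set_mono) (use comp in auto)
  also have "\<dots> = norm A * norm x"
    unfolding norm_vec_def[of A] by (subst L2_set_left_distrib) auto
  finally show ?thesis .
qed

lemma outer_congruence: "K ** outer x ** adj K = outer (K *v x)"
proof -
  have "(K ** outer x ** adj K) $ i $ j = outer (K *v x) $ i $ j" for i j
    by (simp add: outer_def matrix_matrix_mult_def matrix_vector_mult_def adj_def
        sum_distrib_left sum_distrib_right mult_ac)
  then show ?thesis by (simp add: vec_eq_iff)
qed

lemma outer_scaleR: "outer (c *\<^sub>R x) = c\<^sup>2 *\<^sub>R outer x"
  by (simp add: outer_def vec_eq_iff power2_eq_square complex_eq_iff algebra_simps)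

lemma norm_outer_le: "norm (outer x) \<le> (norm x)\<^sup>2"
proof -
  have row: "norm (outer x $ i) = norm (x $ i) * norm x" for i
    unfolding norm_vec_def outer_def by (simp add: norm_mult L2_set_right_distrib)
  show ?thesis
    unfolding norm_vec_def[of "outer x"] row
    by (simp add: L2_set_left_distrib[symmetric] norm_vec_def[of x] power2_eq_square)
qed

lemma Re_mtrace_mult_outer: "Re (mtrace (A ** outer x)) = x \<bullet> (A *v x)"
  by (simp add: mtrace_def outer_def matrix_matrix_mult_def inner_complex_vec matrix_vector_mult_def
      sum_distrib_left mult_ac)

lemma Re_mtrace_outer: "Re (mtrace (outer x)) = (norm x)\<^sup>2"
  using Re_mtrace_mult_outer[of "mat 1" x] by (simp add: power2_norm_eq_inner)

lemma mtrace_linear: "mtrace (c *\<^sub>R A) = c *\<^sub>R mtrace A"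
  "mtrace (\<Sum>i\<in>I. F i) = (\<Sum>i\<in>I. mtrace (F i))"
  by (simp_all add: mtrace_def scaleR_sum_right sum.swap[of _ I])

lemma psd_iff: "psd A \<longleftrightarrow> adj A = A \<and> (\<forall>x. 0 \<le> x \<bullet> (A *v x))"
  by (simp add: psd_def hermitian_def Re_qform)

lemma tendsto_matrix_mult:
  fixes f g :: "'a \<Rightarrow> complex^'n::finite^'n"
  assumes "(f \<longlongrightarrow> A) F" "(g \<longlongrightarrow> B) F"
  shows "((\<lambda>x. f x ** g x) \<longlongrightarrow> A ** B) F"
  unfolding matrix_matrix_mult_def
  by (intro tendsto_vec_lambda tendsto_sum tendsto_mult tendsto_vec_nth assms)

lemma tendsto_mtrace:
  assumes "(f \<longlongrightarrow> A) F" shows "((\<lambda>x. mtrace (f x)) \<longlongrightarrow> mtrace A) F"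
  unfolding mtrace_def by (intro tendsto_sum tendsto_vec_nth assms)

section \<open>Outer-product decomposition of positive semidefinite matrices\<close>

text \<open>Cholesky elimination: subtracting the outer product of the scaled \<open>s\<close>-th column
  keeps the matrix positive semidefinite and clears its \<open>s\<close>-th row and column.\<close>

lemma psd_sum_outer_supported:
  assumes "finite S" "psd A" "\<And>i j. i \<notin> S \<or> j \<notin> S \<Longrightarrow> A $ i $ j = 0"
  shows "\<exists>v. A = (\<Sum>i\<in>S. outer (v i))"
  using assms
proof (induction S arbitrary: A rule: finite_induct)
  case empty
  then show ?case by (simp add: vec_eq_iff)
next
  case (insert s S A)
  have herm: "cnj (A $ j $ i) = A $ i $ j" for i j
  proof -
    have "adj A $ i $ j = A $ i $ j" using insert.prems(1) by (simp add: psd_iff)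
    then show ?thesis by (simp add: adj_def)
  qed
  have nn: "0 \<le> x \<bullet> (A *v x)" for x
    using insert.prems(1) by (simp add: psd_iff)
  define a where "a = Re (A $ s $ s)"
  have Ass: "A $ s $ s = of_real a"
    using herm[of s s] by (simp add: a_def complex_eq_iff)
  define e :: "complex^'a" where "e = axis s 1"
  define r where "r y = (A *v y) $ s" for y
  have Ae: "(A *v (c *s e)) $ i = c * A $ i $ s" for c i
    by (simp add: matrix_vector_mult_def e_def axis_def if_distrib[of "\<lambda>x. _ * x"] cong: if_cong)
  have inner_e: "(c *s e) \<bullet> w = Re (cnj c * w $ s)" for c w
    by (simp add: inner_complex_vec e_def axis_def if_distrib[of "\<lambda>x. x * _"] if_distrib[of cnj]
        if_distrib[of "\<lambda>x. _ * x"] cong: if_cong del: Re_sum)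
  \<comment> \<open>A quadratic polynomial in the shift \<open>c\<close> along the
    \<open>s\<close>-th axis. The case \<open>a = 0\<close> picks \<open>c\<close> so as to make it
    negative, the case \<open>a > 0\<close> picks its minimizer.\<close>
  have expand: "(y - c *s e) \<bullet> (A *v (y - c *s e)) = y \<bullet> (A *v y) - 2 * Re (cnj c * r y) + (cmod c)\<^sup>2 * a" for y c
  proof -
    have "y \<bullet> (A *v (c *s e)) = (c *s e) \<bullet> (A *v y)"
      using insert.prems(1) by (metis inner_matrix_vector inner_commute psd_iff)
    moreover have "(c *s e) \<bullet> (A *v (c *s e)) = (cmod c)\<^sup>2 * a"
      unfolding inner_e Ae Ass cmod_power2 by (simp add: algebra_simps power2_eq_square)
    ultimately show ?thesis
      by (simp add: matrix_vector_mult_diff_distrib inner_diff_left inner_diff_right inner_e r_def)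
  qed
  have "a \<ge> 0"
    using expand[of 0 1] nn[of "0 - 1 *s e"] by (simp add: r_def)
  show ?case
  proof (cases "a = 0")
    case True
    have r0: "r y = 0" for y
    proof (rule ccontr)
      assume "r y \<noteq> 0"
      \<comment> \<open>With \<open>a = 0\<close> the quadratic term is absent, and for this
        \<open>t\<close> the shift \<open>of_real t * r y\<close> gives the form the value
        \<open>-1\<close>.\<close>
      define t where "t = (y \<bullet> (A *v y) + 1) / (2 * (cmod (r y))\<^sup>2)"
      have "Re (cnj (of_real t * r y) * r y) = t * (cmod (r y))\<^sup>2"
        unfolding cmod_power2 by (simp add: algebra_simps power2_eq_square)
      also have "\<dots> = (y \<bullet> (A *v y) + 1) / 2"
        using \<open>r y \<noteq> 0\<close> by (simp add: t_def)
      finally show False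
        using expand[of y "of_real t * r y"] nn[of "y - (of_real t * r y) *s e"] True by simp
    qed
    have row: "A $ s $ j = 0" for j
      using r0[of "axis j 1"] by (simp add: r_def matrix_vector_mult_def axis_def
          if_distrib[of "\<lambda>x. _ * x"] cong: if_cong)
    then have col: "A $ j $ s = 0" for j
      using herm[of s j] by (metis complex_cnj_zero)
    have "A $ i $ j = 0" if "i \<notin> S \<or> j \<notin> S" for i j
      using insert.prems(2)[of i j] that row col by (cases "i = s"; cases "j = s") auto
    with insert.IH[OF insert.prems(1)] obtain v where v: "A = (\<Sum>i\<in>S. outer (v i))" by blast
    have "A = (\<Sum>i\<in>insert s S. outer ((v(s := 0)) i))"
      using insert.hyps by (subst sum.insert)
        (auto simp: v outer_def vec_eq_iff intro!: sum.cong)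
    then show ?thesis by blast
  next
    case False
    then have "a > 0" using \<open>a \<ge> 0\<close> by simp
    define w :: "complex^'a" where "w = (\<chi> i. A $ i $ s / of_real (sqrt a))"
    define B where "B = A - outer w"
    have outer_w: "outer w $ i $ j = A $ i $ s * A $ s $ j / of_real a" for i j
      using \<open>a > 0\<close> by (simp add: outer_def w_def herm power2_eq_square[symmetric]
          flip: of_real_power of_real_mult)
    have w_inner: "(\<Sum>j\<in>UNIV. cnj (w $ j) * y $ j) = r y / of_real (sqrt a)" for y
      by (simp add: w_def r_def herm matrix_vector_mult_def sum_divide_distrib)
    have "psd B"
      unfolding psd_iff
    proof (intro conjI allI)
      show "adj B = B"
        using insert.prems(1) by (simp add: B_def adj_diff psd_iff)
      fix y
      have "y \<bullet> (B *v y) = y \<bullet> (A *v y) - (cmod (r y))\<^sup>2 / a"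
        using \<open>a > 0\<close>
        by (simp add: B_def matrix_vector_mult_diff_rdistrib inner_diff_right inner_outer w_inner
            norm_divide power_divide)
      \<comment> \<open>The minimizing shift: the form of the Schur complement \<open>B\<close> at
        \<open>y\<close> is the least value of the form of \<open>A\<close> over shifts of
        \<open>y\<close> along \<open>e\<close>.\<close>
      also have "\<dots> = (y - (r y / of_real a) *s e) \<bullet> (A *v (y - (r y / of_real a) *s e))"
      proof -
        have "Re (cnj (r y / of_real a) * r y) = (cmod (r y))\<^sup>2 / a"
          unfolding cmod_power2 by (simp add: algebra_simps power2_eq_square add_divide_distrib)
        moreover have "(cmod (r y / of_real a))\<^sup>2 * a = (cmod (r y))\<^sup>2 / a"
          using \<open>a > 0\<close> by (simp add: norm_divide power_divide power2_eq_square)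
        ultimately show ?thesis unfolding expand by linarith
      qed
      finally show "0 \<le> y \<bullet> (B *v y)" using nn by simp
    qed
    moreover have "B $ i $ j = 0" if "i \<notin> S \<or> j \<notin> S" for i j
      using insert.prems(2)[of i j] insert.prems(2)[of i s] insert.prems(2)[of s j] that \<open>a > 0\<close>
      by (cases "i = s"; cases "j = s") (auto simp: B_def outer_w Ass)
    ultimately obtain v where v: "B = (\<Sum>i\<in>S. outer (v i))" using insert.IH[of B] by blast
    have "A = outer w + B" by (simp add: B_def)
    also have "\<dots> = (\<Sum>i\<in>insert s S. outer ((v(s := w)) i))"
      using insert.hyps by (subst sum.insert) (auto simp: v intro!: sum.cong)
    finally show ?thesis by blast
  qed
qed

lemma psd_sum_outer: "psd A \<Longrightarrow> \<exists>v. A = (\<Sum>i\<in>(UNIV :: 'p set). outer (v i))" for A :: "'p::finite cmat"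
  by (rule psd_sum_outer_supported) auto

text \<open>The vectors of the outer-product decomposition become the columns of
  \<open>L\<close>.\<close>

lemma psd_factorization:
  assumes "psd A" shows "\<exists>L. L ** adj L = A"
proof -
  obtain v :: "'a \<Rightarrow> complex^'a" where "A = (\<Sum>i\<in>UNIV. outer (v i))"
    using psd_sum_outer[OF assms] by blast
  then have "(\<chi> i j. v j $ i) ** adj (\<chi> i j. v j $ i) = A"
    by (simp add: matrix_matrix_mult_def adj_def outer_def vec_eq_iff)
  then show ?thesis by blast
qed

text \<open>Holds for each outer product, and the trace is additive. As the trace is fixed, this
  confines the estimates to a compact ball.\<close>

lemma psd_norm_le_mtrace:
  assumes "psd A" shows "norm A \<le> Re (mtrace A)"
proof -
  obtain v :: "'a \<Rightarrow> complex^'a" where A: "A = (\<Sum>i\<in>UNIV. outer (v i))"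
    using psd_sum_outer[OF assms] by blast
  have "norm A \<le> (\<Sum>i\<in>UNIV. (norm (v i))\<^sup>2)"
    unfolding A by (rule order_trans[OF norm_sum]) (intro sum_mono norm_outer_le)
  also have "\<dots> = Re (mtrace A)"
    unfolding A by (simp add: mtrace_linear Re_mtrace_outer)
  finally show ?thesis .
qed

text \<open>A kernel vector of \<open>adj L\<close> would be one of \<open>A\<close>, so
  \<open>adj L\<close> has a left inverse, whose adjoint inverts \<open>L\<close>.\<close>

lemma pd_factorization_invertible:
  assumes "pd A" "L ** adj L = A"
  obtains K where "L ** K = mat 1" "K ** L = mat 1"
proof -
  have "x = 0" if "adj L *v x = 0" for x
  proof (rule ccontr)
    assume "x \<noteq> 0"
    have "A *v x = 0"
      using that by (simp add: assms(2)[symmetric] matrix_vector_mul_assoc[symmetric])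
    with \<open>x \<noteq> 0\<close> assms(1) show False
      by (auto simp: pd_def Re_qform)
  qed
  then obtain J where "J ** adj L = mat 1"
    using matrix_left_invertible_ker by blast
  then have "L ** adj J = mat 1"
    by (metis adj_adj adj_mat_1 adj_mult)
  then show ?thesis
    using that matrix_left_right_inverse by blast
qed

section \<open>Norms and residuals\<close>

lemma scaleR_eq_cscale: "r *\<^sub>R A = cscale (of_real r) A"
  by (simp add: cscale_def vec_eq_iff) (simp add: scaleR_conv_of_real)

text \<open>Expand \<open>A\<close> in the matrix units \<open>E i j\<close>; each entry is bounded
  by the Frobenius norm.\<close>

lemma matrix_norm_le_norm:
  assumes N: "matrix_norm N"
  obtains C where "C \<ge> 0" "\<And>A. N A \<le> C * norm A"
proof -
  have N0: "N 0 = 0" and tri: "\<And>A B. N (A + B) \<le> N A + N B"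
    and sc: "\<And>c A. N (cscale c A) = cmod c * N A"
    using N by (auto simp: matrix_norm_def)
  \<comment> \<open>From \<open>0 = N (A - A) \<le> 2 * N A\<close>.\<close>
  have nonneg: "0 \<le> N A" for A
    using tri[of A "cscale (-1) A"] sc[of "-1" A] N0
    by (simp add: cscale_def vec_eq_iff[symmetric] plus_vec_def zero_vec_def)
  define E :: "'a \<Rightarrow> 'a \<Rightarrow> 'a cmat" where "E i j = (\<chi> k l. if k = i \<and> l = j then 1 else 0)" for i j
  have N_sum: "N (\<Sum>i\<in>I. f i) \<le> (\<Sum>i\<in>I. N (f i))" if "finite I" for I :: "('a \<times> 'a) set" and f
    using that by (induction I rule: finite_induct) (auto simp: N0 intro: order_trans[OF tri])
  show ?thesis
  proof
    show "0 \<le> (\<Sum>(i, j)\<in>UNIV. N (E i j))"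
      by (intro sum_nonneg) (auto simp: nonneg)
    fix A
    have "A = (\<Sum>(i, j)\<in>UNIV. cscale (A $ i $ j) (E i j))"
    proof -
      have "(\<Sum>x\<in>UNIV. (case x of (i, j) \<Rightarrow> cscale (A $ i $ j) (E i j)) $ k $ l)
          = (\<Sum>x\<in>UNIV. if x = (k, l) then A $ k $ l else 0)" for k l
        by (rule sum.cong) (auto simp: cscale_def E_def split: if_splits)
      then show ?thesis by (simp add: vec_eq_iff)
    qed
    then have "N A = N (\<Sum>(i, j)\<in>UNIV. cscale (A $ i $ j) (E i j))" by simp
    also have "\<dots> \<le> (\<Sum>(i, j)\<in>UNIV. cmod (A $ i $ j) * N (E i j))"
      by (rule order_trans[OF N_sum]) (auto simp: sc intro!: sum_mono)
    also have "\<dots> \<le> (\<Sum>(i, j)\<in>UNIV. norm A * N (E i j))"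
    proof (intro sum_mono, clarify)
      fix i j
      have "cmod (A $ i $ j) \<le> norm A"
        using Finite_Cartesian_Product.norm_nth_le[of A i]
          Finite_Cartesian_Product.norm_nth_le[of "A $ i" j] by linarith
      then show "cmod (A $ i $ j) * N (E i j) \<le> norm A * N (E i j)"
        by (intro mult_right_mono nonneg)
    qed
    finally show "N A \<le> (\<Sum>(i, j)\<in>UNIV. N (E i j)) * norm A"
      by (simp add: sum_distrib_left mult.commute case_prod_unfold)
  qed
qed

text \<open>The upper bound makes \<open>N\<close> Lipschitz, so it attains a positive minimum on
  the compact Frobenius unit sphere; homogeneity does the rest.\<close>

lemma norm_le_matrix_norm:
  assumes N: "matrix_norm N"
  obtains c where "c > 0" "\<And>A. norm A \<le> c * N A"
proof -
  obtain C where C: "C \<ge> 0" "\<And>A. N A \<le> C * norm A"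
    using matrix_norm_le_norm[OF N] by metis
  have tri: "N (A + B) \<le> N A + N B" for A B using N by (auto simp: matrix_norm_def)
  have sc: "N (r *\<^sub>R A) = \<bar>r\<bar> * N A" for r A
    using N by (auto simp: matrix_norm_def scaleR_eq_cscale)
  have N0: "N A = 0 \<longleftrightarrow> A = 0" for A using N by (auto simp: matrix_norm_def)
  have lip: "\<bar>N A - N B\<bar> \<le> C * norm (A - B)" for A B
  proof -
    have "N A - N B \<le> C * norm (A - B)" for A B
      using tri[of "A - B" B] C(2)[of "A - B"] by simp
    from this[of A B] this[of B A] show ?thesis by (simp add: norm_minus_commute)
  qed
  have cont: "continuous_on UNIV N"
    using lip C(1) by (intro lipschitz_on_continuous_on[of C]) (auto simp: dist_norm lipschitz_on_def)
  have "sphere (0 :: 'a cmat) 1 \<noteq> {}" by simp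
  then obtain S where S: "S \<in> sphere 0 1" "\<And>A. A \<in> sphere 0 1 \<Longrightarrow> N S \<le> N A"
    using continuous_attains_inf[of "sphere (0 :: 'a cmat) 1" N] continuous_on_subset[OF cont]
    by (metis compact_sphere top_greatest)
  have "N S \<ge> 0"
    using tri[of S "- S"] sc[of "-1" S] N0[of 0] by simp
  with N0[of S] S(1) have "N S > 0" by (auto simp: less_le)
  show ?thesis
  proof
    show "inverse (N S) > 0" using \<open>N S > 0\<close> by simp
    fix A
    show "norm A \<le> inverse (N S) * N A"
    proof (cases "A = 0")
      case False
      then have "N S \<le> N ((1 / norm A) *\<^sub>R A)" by (intro S(2)) simp
      then show ?thesis
        using False \<open>N S > 0\<close> by (simp add: sc field_simps)
    qed (use N0[of 0] in simp)
  qed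
qed

section \<open>The eigenvector residual\<close>

text \<open>Vanishes for all unit vectors \<open>u\<close> iff \<open>A\<close> is a real multiple of the identity.\<close>

definition eigen_residual :: "'p::finite cmat \<Rightarrow> complex^'p \<Rightarrow> complex^'p" where
  "eigen_residual A u = A *v u - (u \<bullet> (A *v u)) *\<^sub>R u"

lemma eigen_residual_diff:
  "eigen_residual A u - eigen_residual B u = eigen_residual (A - B) u"
  by (simp add: eigen_residual_def matrix_vector_mult_diff_rdistrib inner_diff_right algebra_simps)

lemma norm_eigen_residual_le:
  assumes "norm u \<le> 1" shows "norm (eigen_residual A u) \<le> 2 * norm A"
proof -
  have A: "norm (A *v u) \<le> norm A"
    using norm_matrix_vector_mult_le[of A u] mult_left_le[OF assms norm_ge_zero[of A]] by linarith
  have "norm ((u \<bullet> (A *v u)) *\<^sub>R u) \<le> (norm u * norm (A *v u)) * norm u"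
    by (simp add: mult_right_mono Cauchy_Schwarz_ineq2)
  also have "\<dots> \<le> (1 * norm A) * 1"
    using assms A by (intro mult_mono) auto
  finally show ?thesis
    unfolding eigen_residual_def using A norm_triangle_ineq4[of "A *v u" "(u \<bullet> (A *v u)) *\<^sub>R u"] by simp
qed

text \<open>The residual is linear in the matrix, and
  \<open>(a + 2 * b)^2 \<le> 2 * a^2 + 8 * b^2\<close>. This lets a fixed matrix replace a
  sample-dependent one, uniformly in \<open>u\<close>.\<close>

lemma eigen_residual_perturb:
  assumes "norm u \<le> 1"
  shows "(norm (eigen_residual A u))\<^sup>2 \<le> 2 * (norm (eigen_residual B u))\<^sup>2 + 8 * (norm (A - B))\<^sup>2"
proof -
  have "norm (eigen_residual A u) \<le> norm (eigen_residual B u) + 2 * norm (A - B)"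
    using norm_triangle_sub[of "eigen_residual A u" "eigen_residual B u"]
      norm_eigen_residual_le[OF assms, of "A - B"] by (simp add: eigen_residual_diff)
  then have "(norm (eigen_residual A u))\<^sup>2 \<le> (norm (eigen_residual B u) + 2 * norm (A - B))\<^sup>2"
    by (intro power_mono) auto
  also have "\<dots> \<le> 2 * (norm (eigen_residual B u))\<^sup>2 + 8 * (norm (A - B))\<^sup>2"
    using zero_le_power2[of "norm (eigen_residual B u) - 2 * norm (A - B)"]
    by (simp add: power2_eq_square algebra_simps)
  finally show ?thesis .
qed

text \<open>The axis vectors are eigenvectors with real eigenvalues, so \<open>A\<close> is
  diagonal; sums of two axis vectors are eigenvectors too, which forces equal diagonal
  entries.\<close>

lemma scalar_if_eigen_residual_zero:
  assumes "\<And>z. z \<noteq> 0 \<Longrightarrow> eigen_residual A (sgn z) = 0"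
  obtains c :: real where "A = c *\<^sub>R mat 1"
proof -
  have ev: "\<exists>l. A *v z = l *\<^sub>R z" if "z \<noteq> 0" for z
  proof -
    define l where "l = sgn z \<bullet> (A *v sgn z)"
    have "A *v sgn z = l *\<^sub>R sgn z"
      using assms[OF that] by (simp add: eigen_residual_def l_def)
    then have "norm z *\<^sub>R (A *v sgn z) = norm z *\<^sub>R l *\<^sub>R sgn z" by simp
    then show ?thesis
      using that by (auto simp: matrix_vector_mult_scaleR_right sgn_div_norm)
  qed
  have Aax: "(A *v axis j 1) $ i = A $ i $ j" for i j
    by (simp add: matrix_vector_mult_def axis_def if_distrib[of "\<lambda>x. _ * x"] cong: if_cong)
  have "\<forall>j. \<exists>l. A *v axis j 1 = l *\<^sub>R axis j 1"
    using ev by (simp add: axis_eq_0_iff)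
  then obtain l where l: "A *v axis j 1 = l j *\<^sub>R axis j 1" for j by metis
  have entry: "A $ i $ j = (if i = j then of_real (l j) else 0)" for i j
    using Aax[of j i] unfolding l by (auto simp: axis_def of_real_def split: if_splits)
  have "l i = l j" if "i \<noteq> j" for i j
  proof -
    have "axis i 1 + axis j 1 \<noteq> (0 :: complex^'a)"
    proof
      assume "axis i 1 + axis j 1 = (0 :: complex^'a)"
      then have "(axis i 1 + axis j 1 :: complex^'a) $ i = 0" by simp
      then show False using that by (simp add: axis_def)
    qed
    from ev[OF this] obtain m where "A *v (axis i 1 + axis j 1) = m *\<^sub>R (axis i 1 + axis j 1)" by blast
    then have "(l i *\<^sub>R axis i 1 + l j *\<^sub>R axis j 1 :: complex^'a) = m *\<^sub>R (axis i 1 + axis j 1)"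
      by (simp add: matrix_vector_right_distrib l)
    then have "(l i *\<^sub>R axis i 1 + l j *\<^sub>R axis j 1 :: complex^'a) $ k = (m *\<^sub>R (axis i 1 + axis j 1)) $ k" for k
      by simp
    from this[of i] this[of j] that show ?thesis by (simp add: axis_def)
  qed
  then have l_const: "l j = l undefined" for j by metis
  have "A $ i $ j = (l undefined *\<^sub>R mat 1) $ i $ j" for i j
    using l_const[of j] by (simp add: entry mat_def of_real_def)
  then have "A = l undefined *\<^sub>R mat 1" by (simp add: vec_eq_iff)
  then show ?thesis by (rule that)
qed

lemma linear_matrix_vector_mult: "linear (\<lambda>u. A *v u)" for A :: "complex^'n::finite^'m::finite"
  by (rule linearI) (simp_all add: matrix_vector_right_distrib matrix_vector_mult_scaleR_right)

lemma continuous_on_matrix_vector_mult [continuous_intros]: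
  "continuous_on S f \<Longrightarrow> continuous_on S (\<lambda>x. A *v f x)" for A :: "complex^'n::finite^'m::finite"
  using bounded_linear.continuous_on[of "(*v) A" S f] linear_matrix_vector_mult[of A]
  unfolding linear_conv_bounded_linear by blast

lemma measurable_matrix_vector_mult [measurable]:
  "(\<lambda>u. A *v u) \<in> borel_measurable borel" for A :: "complex^'n::finite^'m::finite"
  by (intro borel_measurable_continuous_onI continuous_intros)

lemma measurable_eigen_residual [measurable]: "eigen_residual A \<in> borel_measurable borel"
  unfolding eigen_residual_def[abs_def] by measurable

text \<open>Clearing denominators turns the residual at \<open>sgn z\<close> into a polynomial in \<open>z\<close>,
  which is continuous also at \<open>0\<close>.\<close>

lemma eigen_residual_zero_if_AE:
  assumes "AE z in lborel. eigen_residual A (sgn z) = 0" "z \<noteq> 0"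
  shows "eigen_residual A (sgn z) = 0"
proof -
  define f where "f z = (z \<bullet> z) *\<^sub>R (A *v z) - (z \<bullet> (A *v z)) *\<^sub>R z" for z
  have f: "f z = (norm z ^ 3) *\<^sub>R eigen_residual A (sgn z)" for z
  proof (cases "z = 0")
    case False
    define r s where "r = norm z" and "s = sgn z"
    have z: "z = r *\<^sub>R s" and ss: "s \<bullet> s = 1"
      using False by (simp_all add: r_def s_def sgn_div_norm power2_norm_eq_inner[symmetric] power_inverse)
    have "f z = r ^ 3 *\<^sub>R eigen_residual A s"
      unfolding f_def z by (simp add: matrix_vector_mult_scaleR_right ss eigen_residual_def
          scaleR_diff_right power3_eq_cube mult_ac)
    then show ?thesis by (simp add: r_def s_def)
  qed (simp add: f_def)
  have "AE z in lborel. f z = 0"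
    using assms(1) by eventually_elim (simp add: f)
  moreover have "continuous_on UNIV f"
    unfolding f_def[abs_def] by (intro continuous_intros)
  ultimately have "f z = 0"
    by (rule continuous_eq_if_AE_lborel)
  then show ?thesis using \<open>z \<noteq> 0\<close> by (simp add: f)
qed

text \<open>The positivity constraint is tested at \<open>u - residual / C\<close>, a gradient step
  from the direction \<open>u\<close> of the sample that decreases the quadratic form of \<open>K T K\<^sup>H\<close>.\<close>

lemma constraint_improved:
  fixes T K :: "'p::finite cmat"
  assumes psd: "psd (T - q *\<^sub>R outer x)" and "q \<ge> 0" and T: "adj T = T"
    and K: "K *v x \<noteq> 0" and M: "M = K ** T ** adj K" and C: "norm M \<le> C" "C > 0"
    and u: "u = sgn (K *v x)"
  shows "q * (norm (K *v x))\<^sup>2 \<le> u \<bullet> (M *v u) - (norm (eigen_residual M u))\<^sup>2 / C"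
proof -
  define v where "v = eigen_residual M u"
  define y where "y = u - (1 / C) *\<^sub>R v"
  have uu: "u \<bullet> u = 1" using K by (simp add: u power2_norm_eq_inner[symmetric] norm_sgn)
  \<comment> \<open>The correction is orthogonal to \<open>u\<close>, so moving from
    \<open>u\<close> to \<open>y\<close> keeps the overlap with \<open>u\<close>.\<close>
  have uv: "u \<bullet> v = 0" by (simp add: v_def eigen_residual_def inner_diff_right uu)
  have Mh: "adj M = M" by (simp add: M adj_mult T matrix_mul_assoc)
  have Mu: "M *v u = v + (u \<bullet> (M *v u)) *\<^sub>R u" by (simp add: v_def eigen_residual_def)
  have vMu: "v \<bullet> (M *v u) = (norm v)\<^sup>2"
    by (subst Mu) (simp add: inner_add_right inner_commute[of v u] uv power2_norm_eq_inner)
  have uMv: "u \<bullet> (M *v v) = (norm v)\<^sup>2"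
    using inner_matrix_vector[of u M v] vMu by (simp add: Mh inner_commute)
  have vMv: "v \<bullet> (M *v v) \<le> C * (norm v)\<^sup>2"
  proof -
    have "v \<bullet> (M *v v) \<le> norm v * norm (M *v v)" by (rule norm_cauchy_schwarz)
    also have "\<dots> \<le> norm v * (C * norm v)"
      using norm_matrix_vector_mult_le[of M v] mult_right_mono[OF C(1) norm_ge_zero[of v]]
      by (intro mult_left_mono) auto
    finally show ?thesis by (simp add: power2_eq_square mult_ac)
  qed
  \<comment> \<open>Step length \<open>1 / C\<close> gives a first-order gain of
    \<open>2 / C\<close> against a second-order loss of at most \<open>1 / C\<close>, both times the
    squared norm of \<open>v\<close>.\<close>
  have "y \<bullet> (M *v y) = u \<bullet> (M *v u) - 2 / C * (norm v)\<^sup>2 + (1 / C)\<^sup>2 * (v \<bullet> (M *v v))"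
    by (simp add: y_def matrix_vector_mult_diff_distrib matrix_vector_mult_scaleR_right inner_diff_left
        inner_diff_right vMu uMv power2_eq_square algebra_simps)
  also have "\<dots> \<le> u \<bullet> (M *v u) - 2 / C * (norm v)\<^sup>2 + (1 / C)\<^sup>2 * (C * (norm v)\<^sup>2)"
    using vMv by (intro add_left_mono mult_left_mono) auto
  also have "\<dots> = u \<bullet> (M *v u) - (norm v)\<^sup>2 / C"
    using C(2) by (simp add: power2_eq_square field_simps)
  finally have yMy: "y \<bullet> (M *v y) \<le> u \<bullet> (M *v u) - (norm v)\<^sup>2 / C" .
  \<comment> \<open>Pulling \<open>y\<close> back by \<open>adj K\<close> turns the form of
    \<open>T\<close> into that of \<open>M\<close>, and the overlap with \<open>x\<close> into that
    of \<open>K *v x\<close> with \<open>y\<close>.\<close>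
  define w where "w = adj K *v y"
  have wTw: "w \<bullet> (T *v w) = y \<bullet> (M *v y)"
    by (simp add: w_def M inner_matrix_vector[of y] adj_mult T matrix_vector_mul_assoc[symmetric])
  have "x \<bullet> w = (K *v x) \<bullet> y"
    by (simp add: w_def inner_matrix_vector)
  also have "K *v x = norm (K *v x) *\<^sub>R u"
    using K by (simp add: u sgn_div_norm)
  also have "(norm (K *v x) *\<^sub>R u) \<bullet> y = norm (K *v x)"
    by (simp add: y_def inner_diff_right uu uv)
  finally have xw: "x \<bullet> w = norm (K *v x)" .
  have "0 \<le> w \<bullet> ((T - q *\<^sub>R outer x) *v w)"
    using psd by (simp add: psd_iff)
  also have "\<dots> = w \<bullet> (T *v w) - q * (w \<bullet> (outer x *v w))"
    by (simp add: matrix_vector_mult_diff_rdistrib matrix_vector_mult_scaleR_left inner_diff_right)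
  finally have "q * (w \<bullet> (outer x *v w)) \<le> y \<bullet> (M *v y)"
    by (simp add: wTw)
  moreover have "q * (norm (K *v x))\<^sup>2 \<le> q * (w \<bullet> (outer x *v w))"
    using inner_outer_ge[of x w] \<open>q \<ge> 0\<close> by (intro mult_left_mono) (simp_all add: xw)
  ultimately show ?thesis
    using yMy by (simp add: v_def)
qed

section \<open>Consistency along a fixed sample\<close>

text \<open>One sample path, with the randomness removed. The vectors \<open>u i\<close> are the
  whitened directions and \<open>second_moment\<close> is their law of large numbers; the laws for
  residuals enter below as the hypothesis \<open>dense\<close>.\<close>

locale coca_sample =
  fixes L K :: "'p::finite cmat" and Theta0 :: "'p cmat"
    and x u :: "nat \<Rightarrow> complex^'p"
  assumes L: "L ** adj L = Theta0" and LK: "L ** K = mat 1" and KL: "K ** L = mat 1"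
    and Kx: "\<And>i. K *v x i \<noteq> 0"
    and u_def: "\<And>i. u i = sgn (K *v x i)"
    and second_moment: "(\<lambda>n. (1 / real n) *\<^sub>R (\<Sum>i<n. outer (u i))) \<longlonglongrightarrow> (1 / CARD('p)) *\<^sub>R mat 1"
begin

lemma norm_u [simp]: "norm (u i) = 1"
  using Kx by (simp add: u_def norm_sgn)

lemma outer_u: "outer (K *v x i) = (norm (K *v x i))\<^sup>2 *\<^sub>R outer (u i)"
proof -
  have "K *v x i = norm (K *v x i) *\<^sub>R u i" using Kx by (simp add: u_def sgn_div_norm)
  then show ?thesis by (metis outer_scaleR)
qed

lemma outer_x: "outer (x i) = (norm (K *v x i))\<^sup>2 *\<^sub>R (L ** outer (u i) ** adj L)"
proof -
  have "outer (x i) = L ** outer (K *v x i) ** adj L"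
    by (simp add: outer_congruence matrix_vector_mul_assoc LK)
  then show ?thesis
    by (simp add: outer_u matrix_mult_scaleR_left matrix_mult_scaleR_right)
qed

lemma adj_LK: "adj K ** adj L = mat 1" "adj L ** adj K = mat 1"
  by (metis LK KL adj_mat_1 adj_mult)+

text \<open>Congruence by \<open>L\<close> reduces each constraint to positivity of
  \<open>mat 1 - outer (u i)\<close>, where \<open>u i\<close> has norm one.\<close>

lemma true_shape_feasible:
  assumes "Theta0 \<in> Sset D0 D k"
  shows "coca_feasible D0 D k x n Theta0 (\<lambda>i. real CARD('p) / (norm (K *v x i))\<^sup>2)"
  unfolding coca_feasible_def
proof (intro conjI allI impI assms)
  fix i
  show "0 < real CARD('p) / (norm (K *v x i))\<^sup>2" using Kx by simp
  have eq: "Theta0 - (real CARD('p) / (norm (K *v x i))\<^sup>2 / real CARD('p)) *\<^sub>R outer (x i)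
      = L ** (mat 1 - outer (u i)) ** adj L" (is "?A = _")
    using Kx by (simp add: outer_x matrix_diff_distrib L)
  show "psd ?A"
    unfolding eq psd_iff
  proof (intro conjI allI)
    show "adj (L ** (mat 1 - outer (u i)) ** adj L) = L ** (mat 1 - outer (u i)) ** adj L"
      by (simp add: adj_mult adj_diff matrix_mul_assoc)
    fix z
    have "z \<bullet> ((L ** (mat 1 - outer (u i)) ** adj L) *v z)
        = (adj L *v z) \<bullet> (adj L *v z) - (adj L *v z) \<bullet> (outer (u i) *v (adj L *v z))"
      by (simp add: matrix_vector_mul_assoc[symmetric] inner_matrix_vector[of z]
          matrix_vector_mult_diff_rdistrib inner_diff_right)
    then show "0 \<le> z \<bullet> ((L ** (mat 1 - outer (u i)) ** adj L) *v z)"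
      using inner_outer_le[of "adj L *v z" "u i"] by (simp add: power2_norm_eq_inner)
  qed
qed

text \<open>The weights cancel the lengths of the \<open>K *v x i\<close>, so the weighted sample
  moment is \<open>CARD('p)\<close> times the empirical moment of the \<open>u i\<close>, conjugated
  by \<open>L\<close>; its limit is \<open>Theta0\<close>.\<close>

lemma obj_true_shape_tendsto_0:
  assumes "matrix_norm N"
  shows "(\<lambda>n. coca_obj N x n Theta0 (\<lambda>i. real CARD('p) / (norm (K *v x i))\<^sup>2)) \<longlonglongrightarrow> 0"
proof -
  obtain C where C: "C \<ge> 0" "\<And>A. N A \<le> C * norm A"
    using matrix_norm_le_norm[OF assms] by metis
  obtain c where c: "c > 0" "\<And>A. norm A \<le> c * N A"
    using norm_le_matrix_norm[OF assms] by metis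
  have nonneg: "0 \<le> N A" for A
    using order_trans[OF norm_ge_zero c(2)[of A]] c(1) by (simp add: zero_le_mult_iff)
  define R where "R n = Theta0 - real CARD('p) *\<^sub>R
      (L ** ((1 / real n) *\<^sub>R (\<Sum>i<n. outer (u i))) ** adj L)" for n
  have obj: "coca_obj N x n Theta0 (\<lambda>i. real CARD('p) / (norm (K *v x i))\<^sup>2) = N (R n)" for n
    unfolding coca_obj_def R_def using Kx
    by (simp add: outer_x matrix_mult_scaleR_left matrix_mult_scaleR_right matrix_sum_distrib
        scaleR_sum_right mult.commute)
  have "R \<longlonglongrightarrow> Theta0 - real CARD('p) *\<^sub>R (L ** ((1 / CARD('p)) *\<^sub>R mat 1) ** adj L)"
    unfolding R_def[abs_def] by (intro tendsto_intros tendsto_matrix_mult second_moment)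
  then have "R \<longlonglongrightarrow> 0"
    by (simp add: matrix_mult_scaleR_left matrix_mult_scaleR_right L)
  then have "(\<lambda>n. C * norm (R n)) \<longlonglongrightarrow> 0"
    by (auto intro!: tendsto_eq_intros)
  then show ?thesis
    unfolding obj by (rule tendsto_sandwich[OF _ _ tendsto_const, rotated 2])
      (use C nonneg in auto)
qed

text \<open>The average of \<open>constraint_improved\<close> over the sample, with both means
  written as traces so that limits can be taken in the matrices.\<close>

lemma mean_residual_le:
  assumes feas: "\<And>i. i < n \<Longrightarrow> 0 < d i \<and> psd (T - (d i / real CARD('p)) *\<^sub>R outer (x i))"
    and "psd T" and M: "M = K ** T ** adj K" "norm M \<le> C" "C > 0"
  defines "S \<equiv> (1 / real n) *\<^sub>R (\<Sum>i<n. d i *\<^sub>R outer (x i))"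
    and "A \<equiv> (1 / real n) *\<^sub>R (\<Sum>i<n. outer (u i))"
  shows "(\<Sum>i<n. (norm (eigen_residual M (u i)))\<^sup>2) / real n
      \<le> C * (Re (mtrace (M ** A)) - Re (mtrace (K ** S ** adj K)) / real CARD('p))"
proof -
  \<comment> \<open>The trace of \<open>K ** (d i *\<^sub>R outer (x i)) ** adj K\<close>.\<close>
  define c where "c i = d i * (norm (K *v x i))\<^sup>2" for i
  have bound: "(norm (eigen_residual M (u i)))\<^sup>2 \<le> C * (u i \<bullet> (M *v u i) - c i / real CARD('p))"
    if "i < n" for i
  proof -
    have "d i / real CARD('p) * (norm (K *v x i))\<^sup>2
        \<le> u i \<bullet> (M *v u i) - (norm (eigen_residual M (u i)))\<^sup>2 / C"
      using feas[OF that] \<open>psd T\<close> Kx M u_def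
      by (intro constraint_improved[where T = T and K = K]) (auto simp: psd_iff)
    then show ?thesis using \<open>C > 0\<close> by (simp add: c_def field_simps)
  qed
  have MA: "Re (mtrace (M ** A)) = (\<Sum>i<n. u i \<bullet> (M *v u i)) / real n"
    by (simp add: A_def matrix_mult_scaleR_right matrix_sum_distrib mtrace_linear Re_mtrace_mult_outer
        del: Re_sum)
       (simp add: Re_mtrace_mult_outer)
  have KSK: "K ** S ** adj K = (1 / real n) *\<^sub>R (\<Sum>i<n. c i *\<^sub>R outer (u i))"
    by (simp add: S_def matrix_mult_scaleR_right matrix_mult_scaleR_left matrix_sum_distrib
        outer_congruence outer_u c_def)
  have KS: "Re (mtrace (K ** S ** adj K)) = (\<Sum>i<n. c i) / real n"
    unfolding KSK by (simp add: mtrace_linear Re_mtrace_outer)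
  have "(\<Sum>i<n. (norm (eigen_residual M (u i)))\<^sup>2) / real n
      \<le> (\<Sum>i<n. C * (u i \<bullet> (M *v u i) - c i / real CARD('p))) / real n"
    by (intro divide_right_mono sum_mono bound) auto
  also have "\<dots> = C * (Re (mtrace (M ** A)) - Re (mtrace (K ** S ** adj K)) / real CARD('p))"
    unfolding MA KS
    by (simp add: sum_distrib_left[symmetric] sum_subtractf sum_divide_distrib[symmetric] diff_divide_distrib
        right_diff_distrib)
  finally show ?thesis .
qed

text \<open>Each \<open>M (s n)\<close> may depend on the sample, so the law of large numbers is
  applied to a fixed \<open>B\<close> near the limit \<open>M'\<close> instead. The mean residual of
  \<open>M (s n)\<close> vanishes in the limit, so that of \<open>B\<close> is small, hence so is
  its expectation, and that of \<open>M'\<close> is zero.\<close>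

lemma cluster_point_scalar:
  fixes T S :: "nat \<Rightarrow> 'p cmat" and s :: "nat \<Rightarrow> nat"
  assumes s: "strict_mono s" and T: "(\<lambda>n. T (s n)) \<longlonglongrightarrow> T'"
    and psd: "\<And>n. n \<ge> 1 \<Longrightarrow> psd (T n)"
    and feas: "\<And>n i. n \<ge> 1 \<Longrightarrow> i < n \<Longrightarrow> 0 < d n i \<and> psd (T n - (d n i / real CARD('p)) *\<^sub>R outer (x i))"
    and obj: "(\<lambda>n. T n - (1 / real n) *\<^sub>R (\<Sum>i<n. d n i *\<^sub>R outer (x i))) \<longlonglongrightarrow> 0"
    and prob: "prob_space (cgauss :: (complex^'p) measure)"
    and dense: "\<And>A e. e > 0 \<Longrightarrow> \<exists>B. norm (A - B) < e \<and>
      (\<lambda>n. (\<Sum>i<n. (norm (eigen_residual B (u i)))\<^sup>2) / real n)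
        \<longlonglongrightarrow> (\<integral>z. (norm (eigen_residual B (sgn z)))\<^sup>2 \<partial>cgauss)"
  obtains c :: real where "T' = c *\<^sub>R Theta0"
proof -
  interpret prob_space "cgauss :: (complex^'p) measure" by fact
  define M where "M n = K ** T n ** adj K" for n
  define M' where "M' = K ** T' ** adj K"
  define S where "S n = (1 / real n) *\<^sub>R (\<Sum>i<n. d n i *\<^sub>R outer (x i))" for n
  define A where "A n = (1 / real n) *\<^sub>R (\<Sum>i<n. outer (u i))" for n
  define F where "F B n = (\<Sum>i<n. (norm (eigen_residual B (u i)))\<^sup>2) / real n" for B n
  define G where "G B = (\<integral>z. (norm (eigen_residual B (sgn z)))\<^sup>2 \<partial>(cgauss :: (complex^'p) measure))" for B
  have M_lim: "(\<lambda>n. M (s n)) \<longlonglongrightarrow> M'"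
    unfolding M_def M'_def by (intro tendsto_matrix_mult tendsto_const T)
  have S_lim: "(\<lambda>n. S (s n)) \<longlonglongrightarrow> T'"
    using tendsto_diff[OF T LIMSEQ_subseq_LIMSEQ[OF obj s]] by (simp add: S_def o_def)
  have A_lim: "(\<lambda>n. A (s n)) \<longlonglongrightarrow> (1 / CARD('p)) *\<^sub>R mat 1"
    using LIMSEQ_subseq_LIMSEQ[OF second_moment s] by (simp add: A_def o_def)
  obtain C where C: "C > 0" "\<And>n. norm (M (s n)) \<le> C"
    using convergent_imp_Bseq[OF convergentI[OF M_lim]] by (auto simp: Bseq_def)
  have s_ge: "s n \<ge> 1" if "n \<ge> 1" for n
    using seq_suble[OF s, of n] that by linarith
  have F_le: "F (M (s n)) (s n)
      \<le> C * (Re (mtrace (M (s n) ** A (s n))) - Re (mtrace (K ** S (s n) ** adj K)) / real CARD('p))"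
    if "n \<ge> 1" for n
    unfolding F_def A_def S_def
    by (rule mean_residual_le[where T = "T (s n)"]) (use feas psd s_ge[OF that] C in \<open>auto simp: M_def\<close>)
  have rhs_lim: "(\<lambda>n. C * (Re (mtrace (M (s n) ** A (s n))) - Re (mtrace (K ** S (s n) ** adj K)) / real CARD('p)))
      \<longlonglongrightarrow> C * (Re (mtrace (M' ** ((1 / CARD('p)) *\<^sub>R mat 1))) - Re (mtrace (K ** T' ** adj K)) / real CARD('p))"
    by (intro tendsto_intros tendsto_mtrace tendsto_matrix_mult M_lim A_lim S_lim) auto
  \<comment> \<open>Both terms are the trace of \<open>M'\<close> divided by the dimension, because
    \<open>S (s n)\<close> and \<open>T (s n)\<close> share the limit \<open>T'\<close>.\<close>
  have rhs0: "C * (Re (mtrace (M' ** ((1 / CARD('p)) *\<^sub>R mat 1))) - Re (mtrace (K ** T' ** adj K)) / real CARD('p)) = 0"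
    by (simp add: matrix_mult_scaleR_right mtrace_linear M'_def)
  have int: "integrable cgauss (\<lambda>z :: complex^'p. (norm (eigen_residual Q (sgn z)))\<^sup>2)" for Q
  proof (rule integrable_const_bound[where B = "(2 * norm Q)\<^sup>2"])
    have "norm ((norm (eigen_residual Q (sgn z)))\<^sup>2) \<le> (2 * norm Q)\<^sup>2" for z
      using power_mono[OF norm_eigen_residual_le[of "sgn z" Q] norm_ge_zero, of 2] by (simp add: norm_sgn)
    then show "AE z in cgauss. norm ((norm (eigen_residual Q (sgn z :: complex^'p)))\<^sup>2) \<le> (2 * norm Q)\<^sup>2"
      by simp
  qed measurable
  \<comment> \<open>The constant is \<open>2 * 8 + 8\<close>: first \<open>G B\<close> is at most
    \<open>8 * e^2\<close>, then passing from \<open>B\<close> to \<open>M'\<close> doubles this and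
    adds \<open>8 * e^2\<close> again.\<close>
  have G_small: "G M' \<le> 24 * e\<^sup>2" if e: "e > 0" for e
  proof -
    obtain B where B: "norm (M' - B) < e" "F B \<longlonglongrightarrow> G B"
      using dense[OF e, of M'] unfolding F_def[abs_def] G_def by blast
    have e2: "(norm (M' - B))\<^sup>2 \<le> e\<^sup>2" using B(1) by (intro power_mono) auto
    have FB_le: "F B n \<le> 2 * F Q n + 8 * (norm (B - Q))\<^sup>2" if "n \<ge> 1" for n Q
    proof -
      have "(\<Sum>i<n. (norm (eigen_residual B (u i)))\<^sup>2)
          \<le> (\<Sum>i<n. 2 * (norm (eigen_residual Q (u i)))\<^sup>2 + 8 * (norm (B - Q))\<^sup>2)"
        by (intro sum_mono eigen_residual_perturb) simp
      then have "F B n \<le> (\<Sum>i<n. 2 * (norm (eigen_residual Q (u i)))\<^sup>2 + 8 * (norm (B - Q))\<^sup>2) / real n"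
        unfolding F_def by (intro divide_right_mono) auto
      also have "\<dots> = 2 * F Q n + 8 * (norm (B - Q))\<^sup>2"
        using that by (simp add: F_def sum.distrib sum_distrib_left[symmetric] add_divide_distrib)
      finally show ?thesis .
    qed
    have "G B \<le> 2 * 0 + 8 * (norm (B - M'))\<^sup>2"
    proof (rule tendsto_le[OF sequentially_bot])
      show "(\<lambda>n. F B (s n)) \<longlonglongrightarrow> G B"
        using LIMSEQ_subseq_LIMSEQ[OF B(2) s] by (simp add: o_def)
      show "(\<lambda>n. 2 * (C * (Re (mtrace (M (s n) ** A (s n))) - Re (mtrace (K ** S (s n) ** adj K)) / real CARD('p)))
          + 8 * (norm (B - M (s n)))\<^sup>2) \<longlonglongrightarrow> 2 * 0 + 8 * (norm (B - M'))\<^sup>2"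
        by (intro tendsto_intros rhs_lim[unfolded rhs0] M_lim)
      show "\<forall>\<^sub>F n in sequentially. F B (s n) \<le>
          2 * (C * (Re (mtrace (M (s n) ** A (s n))) - Re (mtrace (K ** S (s n) ** adj K)) / real CARD('p)))
          + 8 * (norm (B - M (s n)))\<^sup>2"
        using eventually_ge_at_top[of 1]
      proof eventually_elim
        case (elim n)
        show ?case
          using FB_le[OF s_ge[OF elim], of "M (s n)"] F_le[OF elim] by linarith
      qed
    qed
    then have GB: "G B \<le> 8 * e\<^sup>2" using e2 by (simp add: norm_minus_commute)
    have "G M' \<le> (\<integral>z. 2 * (norm (eigen_residual B (sgn z)))\<^sup>2 + 8 * (norm (M' - B))\<^sup>2
        \<partial>(cgauss :: (complex^'p) measure))"
      unfolding G_def using int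
      by (intro integral_mono eigen_residual_perturb) (auto simp: norm_sgn)
    also have "\<dots> = 2 * G B + 8 * (norm (M' - B))\<^sup>2"
      unfolding G_def using int by (simp add: prob_space[simplified])
    finally show ?thesis using GB e2 by linarith
  qed
  have "G M' \<le> 0"
  proof (rule ccontr)
    assume "\<not> G M' \<le> 0"
    \<comment> \<open>For this \<open>e\<close> the bound \<open>24 * e^2\<close> is half of
      \<open>G M'\<close>.\<close>
    then show False using G_small[of "sqrt (G M' / 48)"] by simp
  qed
  moreover have "G M' \<ge> 0" unfolding G_def by simp
  ultimately have "(\<integral>z. (norm (eigen_residual M' (sgn z)))\<^sup>2 \<partial>(cgauss :: (complex^'p) measure)) = 0"
    unfolding G_def by linarith
  then have "AE z in cgauss. (norm (eigen_residual M' (sgn z)))\<^sup>2 = 0"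
    using int by (subst (asm) integral_nonneg_eq_0_iff_AE) auto
  then have "AE z in lborel. eigen_residual M' (sgn z) = 0"
    by (simp add: AE_cgauss_iff)
  then obtain c :: real where c: "M' = c *\<^sub>R mat 1"
    using scalar_if_eigen_residual_zero eigen_residual_zero_if_AE by metis
  have "T' = L ** M' ** adj L"
    by (simp add: M'_def matrix_mul_assoc LK) (simp add: matrix_mul_assoc[symmetric] adj_LK)
  then have "T' = c *\<^sub>R Theta0"
    by (simp add: c matrix_mult_scaleR_left matrix_mult_scaleR_right L)
  then show ?thesis by (rule that)
qed

text \<open>Estimates staying away from \<open>Theta0\<close> along a subsequence would have a
  cluster point by compactness; it is a multiple of \<open>Theta0\<close> with the same nonzero
  trace, hence \<open>Theta0\<close> itself.\<close>

lemma coca_estimate_tendsto: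
  assumes N: "matrix_norm N"
    and trace: "\<forall>A\<in>affset D0 D k. mtrace A = of_nat CARD('p)"
    and Theta0: "Theta0 \<in> Sset D0 D k"
    and est: "\<And>n. n \<ge> 1 \<Longrightarrow> is_coca_estimate N D0 D k x n (T n)"
    and prob: "prob_space (cgauss :: (complex^'p) measure)"
    and dense: "\<And>A e. e > 0 \<Longrightarrow> \<exists>B. norm (A - B) < e \<and>
      (\<lambda>n. (\<Sum>i<n. (norm (eigen_residual B (u i)))\<^sup>2) / real n)
        \<longlonglongrightarrow> (\<integral>z. (norm (eigen_residual B (sgn z)))\<^sup>2 \<partial>cgauss)"
  shows "T \<longlonglongrightarrow> Theta0"
proof -
  define d0 where "d0 = (\<lambda>i. real CARD('p) / (norm (K *v x i))\<^sup>2)"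
  \<comment> \<open>Optimality is used only against the feasible pair \<open>Theta0\<close>,
    \<open>d0\<close>.\<close>
  have "\<forall>n. \<exists>d. n \<ge> 1 \<longrightarrow> coca_feasible D0 D k x n (T n) d \<and>
      coca_obj N x n (T n) d \<le> coca_obj N x n Theta0 d0"
    using est true_shape_feasible[OF Theta0] unfolding is_coca_estimate_def d0_def by blast
  then obtain d where d: "\<And>n. n \<ge> 1 \<Longrightarrow> coca_feasible D0 D k x n (T n) (d n)"
      "\<And>n. n \<ge> 1 \<Longrightarrow> coca_obj N x n (T n) (d n) \<le> coca_obj N x n Theta0 d0"
    by metis
  define R where "R n = T n - (1 / real n) *\<^sub>R (\<Sum>i<n. d n i *\<^sub>R outer (x i))" for n
  obtain c where c: "c > 0" "\<And>A. norm A \<le> c * N A"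
    using norm_le_matrix_norm[OF N] by metis
  have "(\<lambda>n. c * coca_obj N x n Theta0 d0) \<longlonglongrightarrow> 0"
    using tendsto_mult_left[OF obj_true_shape_tendsto_0[OF N], of c] by (simp add: d0_def)
  moreover have "\<forall>\<^sub>F n in sequentially. norm (R n) \<le> c * coca_obj N x n Theta0 d0"
    using eventually_ge_at_top[of 1]
  proof eventually_elim
    case (elim n)
    have "norm (R n) \<le> c * coca_obj N x n (T n) (d n)"
      unfolding coca_obj_def R_def by (rule c(2))
    also have "\<dots> \<le> c * coca_obj N x n Theta0 d0"
      using d(2)[OF elim] c(1) by simp
    finally show ?case .
  qed
  ultimately have R: "R \<longlonglongrightarrow> 0"
    by (rule Lim_null_comparison[rotated])
  have T_props: "psd (T n)" "mtrace (T n) = of_nat CARD('p)" "norm (T n) \<le> real CARD('p)" if "n \<ge> 1" for n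
  proof -
    have "T n \<in> Sset D0 D k" using d(1)[OF that] by (simp add: coca_feasible_def)
    then show "psd (T n)" "mtrace (T n) = of_nat CARD('p)" using trace by (auto simp: Sset_def)
    then show "norm (T n) \<le> real CARD('p)" using psd_norm_le_mtrace[of "T n"] by simp
  qed
  show ?thesis
  proof (rule tendstoI, rule ccontr)
    fix e :: real
    assume "e > 0" and not: "\<not> (\<forall>\<^sub>F n in sequentially. dist (T n) Theta0 < e)"
    \<comment> \<open>The premise \<open>n \<ge> 1\<close> inside the negation keeps index
      \<open>0\<close>, where \<open>T\<close> is unconstrained, out of the set of bad
      indices.\<close>
    have "infinite {n. \<not> (n \<ge> 1 \<longrightarrow> dist (T n) Theta0 < e)}"
    proof
      assume "finite {n. \<not> (n \<ge> 1 \<longrightarrow> dist (T n) Theta0 < e)}"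
      then have "\<forall>\<^sub>F n in sequentially. n \<ge> 1 \<longrightarrow> dist (T n) Theta0 < e"
        by (simp only: eventually_cofinite[symmetric] cofinite_eq_sequentially)
      then have "\<forall>\<^sub>F n in sequentially. dist (T n) Theta0 < e"
        using eventually_ge_at_top[of 1] by eventually_elim simp
      with not show False ..
    qed
    then obtain r :: "nat \<Rightarrow> nat" where r: "strict_mono r" "\<And>n. r n \<ge> 1" "\<And>n. e \<le> dist (T (r n)) Theta0"
      using infinite_enumerate by (metis (mono_tags, lifting) mem_Collect_eq not_less)
    have "seq_compact (cball (0 :: 'p cmat) (real CARD('p)))"
      by (simp add: compact_imp_seq_compact)
    moreover have "\<forall>n. T (r n) \<in> cball 0 (real CARD('p))"
      using T_props(3) r(2) by simp
    ultimately obtain T' q where q: "strict_mono (q :: nat \<Rightarrow> nat)" "((\<lambda>n. T (r n)) \<circ> q) \<longlonglongrightarrow> T'"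
      by (meson seq_compactE)
    have lim: "(\<lambda>n. T ((r \<circ> q) n)) \<longlonglongrightarrow> T'" using q(2) by (simp add: o_def)
    obtain c :: real where c: "T' = c *\<^sub>R Theta0"
    proof (rule cluster_point_scalar[where d = d, OF _ lim T_props(1) _ R[unfolded R_def[abs_def]] prob dense])
      show "strict_mono (r \<circ> q)" using r(1) q(1) by (rule strict_mono_o)
      show "0 < d n i \<and> psd (T n - (d n i / real CARD('p)) *\<^sub>R outer (x i))" if "n \<ge> 1" "i < n" for n i
        using d(1)[OF that(1)] that(2) by (simp add: coca_feasible_def)
    qed
    have "(\<lambda>n. mtrace (T ((r \<circ> q) n))) \<longlonglongrightarrow> mtrace T'"
      by (intro tendsto_mtrace lim)
    moreover have "mtrace (T ((r \<circ> q) n)) = of_nat CARD('p)" for n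
      using T_props(2) r(2) by simp
    ultimately have "mtrace T' = of_nat CARD('p)"
      by (simp add: LIMSEQ_const_iff)
    moreover have "mtrace Theta0 = of_nat CARD('p)"
      using trace Theta0 by (simp add: Sset_def)
    ultimately have "c *\<^sub>R (of_nat CARD('p) :: complex) = of_nat CARD('p)"
      by (simp add: c mtrace_linear)
    then have "c = 1" by (simp add: scaleR_conv_of_real)
    then have "(\<lambda>n. T ((r \<circ> q) n)) \<longlonglongrightarrow> Theta0" using lim c by simp
    then have "\<forall>\<^sub>F n in sequentially. dist (T ((r \<circ> q) n)) Theta0 < e"
      using \<open>e > 0\<close> by (rule tendstoD)
    then obtain n where "dist (T ((r \<circ> q) n)) Theta0 < e"
      using eventually_happens' sequentially_bot by blast
    with r(3)[of "q n"] show False by simp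
  qed
qed

end

section \<open>Almost sure consistency\<close>

text \<open>\<open>sgn\<close> ignores positive factors, so the normalization between
  \<open>L\<close> and \<open>K\<close> has no effect. Whitening a sample thus recovers the
  direction of the Gaussian vector.\<close>

lemma sgn_inverse_sgn:
  fixes K L :: "'p::finite cmat"
  assumes "K ** L = mat 1"
  shows "sgn (K *v sgn (L *v z)) = sgn z"
proof (cases "z = 0")
  case False
  have KL: "K *v (L *v z) = z" by (simp add: matrix_vector_mul_assoc assms)
  then have "L *v z \<noteq> 0" using False by auto
  then show ?thesis
    by (simp add: sgn_div_norm[of "L *v z"] matrix_vector_mult_scaleR_right KL sgn_scaleR)
qed (simp add: sgn_zero)

theorem theorem2:
  fixes M :: "'w measure"
    and D0 :: "complex^'p::finite^'p" and D :: "nat \<Rightarrow> complex^'p^'p" and k :: nat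
    and N :: "complex^'p^'p \<Rightarrow> real"
    and Theta0 :: "complex^'p^'p"
    and X :: "nat \<Rightarrow> 'w \<Rightarrow> complex^'p"
    and That :: "nat \<Rightarrow> 'w \<Rightarrow> complex^'p^'p"
  assumes "psd D0"
    and "\<forall>i\<in>{1..k}. hermitian (D i)"
    and "\<forall>A\<in>affset D0 D k. mtrace A = of_nat CARD('p)"
    and "Theta0 \<in> Sset D0 D k" and "pd Theta0"
    and "prob_space M"
    and "prob_space.indep_vars M (\<lambda>_. borel) X UNIV"
    and "\<forall>i. distr M borel (X i) = cae_dist Theta0"
    and "matrix_norm N"
    and "AE w in M. \<forall>n\<ge>1. is_coca_estimate N D0 D k (\<lambda>i. X i w) n (That n w)"
  shows "AE w in M. (\<lambda>n. That n w) \<longlonglongrightarrow> Theta0"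
proof -
  interpret M: prob_space M by fact
  note indep = assms(7)
  have "psd Theta0" using assms(4) by (simp add: Sset_def)
  \<comment> \<open>The same choice as in \<open>cae_dist\<close>, so that the sampling law unfolds
    to this \<open>L\<close>.\<close>
  define L :: "'p cmat" where "L = (SOME L. L ** adj L = Theta0)"
  have L: "L ** adj L = Theta0"
    unfolding L_def by (rule someI_ex) (rule psd_factorization[OF \<open>psd Theta0\<close>])
  then obtain K where LK: "L ** K = mat 1" and KL: "K ** L = mat 1"
    using pd_factorization_invertible[OF assms(5)] by metis
  have cae: "cae_dist Theta0 = distr cgauss borel (\<lambda>z. sgn (L *v z))"
    unfolding cae_dist_def Let_def L_def[symmetric] by (simp add: sgn_div_norm inverse_eq_divide)
  have dist: "distr M borel (X i) = cae_dist Theta0" for i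
    using assms(8) by simp
  have X [measurable]: "X i \<in> borel_measurable M" for i
    using indep by (auto simp: M.indep_vars_def)
  have "prob_space (cae_dist Theta0)"
    unfolding dist[of 0, symmetric] by (rule M.prob_space_distr) simp
  \<comment> \<open>The law of \<open>X 0\<close> has mass one and is a pushforward of
    \<open>cgauss\<close>, so \<open>cgauss\<close> has mass one; no Gaussian integral is
    evaluated.\<close>
  then have cgauss: "prob_space (cgauss :: (complex^'p) measure)"
    unfolding cae by (rule prob_space_distrD[rotated]) measurable
  define U where "U i w = sgn (K *v X i w)" for i w
  have law: "(\<integral>x. h (sgn (K *v x)) \<partial>cae_dist Theta0) = (\<integral>z. h (sgn z) \<partial>cgauss)"
    if [measurable]: "h \<in> borel_measurable borel"
    for h :: "complex^'p \<Rightarrow> 'b::{banach, second_countable_topology}"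
    unfolding cae by (subst integral_distr) (simp_all add: sgn_inverse_sgn[OF KL])
  have norm_U: "norm (sgn y) \<le> 1" for y :: "complex^'p"
    by (simp add: norm_sgn)

  have ae_nonzero: "AE w in M. \<forall>i. K *v X i w \<noteq> 0"
  proof (subst AE_all_countable, intro allI)
    fix i
    \<comment> \<open>The normalization of \<open>K *v sgn (L *v z)\<close> is \<open>sgn z\<close>,
      which is nonzero unless \<open>z = 0\<close>.\<close>
    have "AE z in (cgauss :: (complex^'p) measure). K *v sgn (L *v z) \<noteq> 0"
      using AE_cgauss_nonzero
    proof eventually_elim
      case (elim z)
      then show ?case using sgn_inverse_sgn[OF KL, of z] by (auto simp: sgn_zero_iff)
    qed
    then have "AE x in cae_dist Theta0. K *v x \<noteq> 0"
      unfolding cae by (subst AE_distr_iff) auto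
    then show "AE w in M. K *v X i w \<noteq> 0"
      unfolding dist[of i, symmetric] by (subst (asm) AE_distr_iff) auto
  qed

  have ae_entry: "AE w in M. (\<lambda>n. (\<Sum>i<n. U i w $ a * cnj (U i w $ b)) / of_nat n)
      \<longlonglongrightarrow> (if a = b then 1 / of_nat CARD('p) else 0)" for a b
  proof -
    have "cmod (sgn y $ a * cnj (sgn y $ b)) \<le> 1" for y :: "complex^'p"
      unfolding norm_mult complex_mod_cnj by (intro mult_le_one norm_nth_sgn_le norm_ge_zero)
    then have "AE w in M. (\<lambda>n. (\<Sum>i<n. U i w $ a * cnj (U i w $ b)) / of_nat n)
      \<longlonglongrightarrow> (\<integral>x. sgn (K *v x) $ a * cnj (sgn (K *v x) $ b) \<partial>cae_dist Theta0)"
      unfolding U_def by (intro M.strong_law_bounded_iid_complex[OF indep dist]) measurable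
    also have "(\<integral>x. sgn (K *v x) $ a * cnj (sgn (K *v x) $ b) \<partial>cae_dist Theta0)
        = (\<integral>z. sgn z $ a * cnj (sgn z $ b) \<partial>cgauss)"
      by (rule law[of "\<lambda>y. y $ a * cnj (y $ b)"]) measurable
    finally show ?thesis by (simp only: integral_cgauss_outer_sgn[OF cgauss])
  qed
  have ae_moment: "AE w in M. (\<lambda>n. (1 / real n) *\<^sub>R (\<Sum>i<n. outer (U i w))) \<longlonglongrightarrow> (1 / CARD('p)) *\<^sub>R mat 1"
  proof -
    have "AE w in M. \<forall>a b. (\<lambda>n. (\<Sum>i<n. U i w $ a * cnj (U i w $ b)) / of_nat n)
        \<longlonglongrightarrow> (if a = b then 1 / of_nat CARD('p) else 0)"
      by (subst AE_all_countable, intro allI, subst AE_all_countable, intro allI ae_entry)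
    then show ?thesis
    proof eventually_elim
      case (elim w)
      have lim: "(\<lambda>n. \<chi> a b. (\<Sum>i<n. U i w $ a * cnj (U i w $ b)) / of_nat n)
          \<longlonglongrightarrow> (\<chi> a b. if a = b then 1 / of_nat CARD('p) else (0 :: complex))"
        using elim by (intro tendsto_vec_lambda) blast
      have "(\<chi> a b. (\<Sum>i<n. U i w $ a * cnj (U i w $ b)) / of_nat n)
          = (1 / real n) *\<^sub>R (\<Sum>i<n. outer (U i w))" for n
        by (simp add: vec_eq_iff outer_def complex_eq_iff Re_divide_of_nat Im_divide_of_nat)
      moreover have "(\<chi> a b. if a = b then 1 / of_nat CARD('p) else 0) = (1 / CARD('p)) *\<^sub>R (mat 1 :: 'p cmat)"
        by (simp add: vec_eq_iff mat_def complex_eq_iff Re_divide_of_nat Im_divide_of_nat)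
      ultimately show ?case using lim by (simp only:)
    qed
  qed

  define G where "G B = (\<integral>z. (norm (eigen_residual B (sgn z)))\<^sup>2 \<partial>(cgauss :: (complex^'p) measure))" for B
  have ae_residual: "AE w in M. (\<lambda>n. (\<Sum>i<n. (norm (eigen_residual B (U i w)))\<^sup>2) / real n) \<longlonglongrightarrow> G B" for B
  proof -
    have "\<bar>(norm (eigen_residual B (sgn y)))\<^sup>2\<bar> \<le> (2 * norm B)\<^sup>2" for y
      using power_mono[OF norm_eigen_residual_le[OF norm_U, of B y] norm_ge_zero, of 2] by simp
    then have "AE w in M. (\<lambda>n. (\<Sum>i<n. (norm (eigen_residual B (U i w)))\<^sup>2) / real n)
        \<longlonglongrightarrow> (\<integral>x. (norm (eigen_residual B (sgn (K *v x))))\<^sup>2 \<partial>cae_dist Theta0)"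
      unfolding U_def by (intro M.strong_law_bounded_iid_real[OF indep dist]) measurable
    also have "(\<integral>x. (norm (eigen_residual B (sgn (K *v x))))\<^sup>2 \<partial>cae_dist Theta0) = G B"
      unfolding G_def by (rule law[of "\<lambda>y. (norm (eigen_residual B y))\<^sup>2"]) measurable
    finally show ?thesis .
  qed
  \<comment> \<open>The null set in \<open>ae_residual\<close> depends on \<open>B\<close>;
    restricting \<open>B\<close> to a countable dense set gives one null set, fixed independently of
    the estimates.\<close>
  obtain Q :: "'p cmat set" where Q: "countable Q"
      "\<And>V. open V \<Longrightarrow> V \<noteq> {} \<Longrightarrow> \<exists>B\<in>Q. B \<in> V"
    by (rule countable_dense_setE) blast
  have "AE w in M. \<forall>B\<in>Q. (\<lambda>n. (\<Sum>i<n. (norm (eigen_residual B (U i w)))\<^sup>2) / real n) \<longlonglongrightarrow> G B"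
    by (subst AE_ball_countable[OF Q(1)]) (use ae_residual in blast)
  with ae_nonzero ae_moment assms(10) show ?thesis
  proof eventually_elim
    case (elim w)
    interpret coca_sample L K Theta0 "\<lambda>i. X i w" "\<lambda>i. U i w"
      using elim(1,2) L LK KL by unfold_locales (auto simp: U_def)
    show ?case
    proof (rule coca_estimate_tendsto[OF assms(9,3,4) _ cgauss])
      show "is_coca_estimate N D0 D k (\<lambda>i. X i w) n (That n w)" if "n \<ge> 1" for n
        using elim(3) that by simp
      fix A :: "'p cmat" and e :: real
      assume "e > 0"
      then have "\<exists>B\<in>Q. B \<in> ball A e" by (intro Q(2)) auto
      then show "\<exists>B. norm (A - B) < e \<and> (\<lambda>n. (\<Sum>i<n. (norm (eigen_residual B (U i w)))\<^sup>2) / real n)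
          \<longlonglongrightarrow> (\<integral>z. (norm (eigen_residual B (sgn z)))\<^sup>2 \<partial>cgauss)"
        using elim(4) unfolding G_def by (auto simp: dist_norm)
    qed
  qed
qed

end
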